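(* Let $\mathbb{F}$ be an algebraically closed field of characteristic $0$, let $k\geq 18$ be an integer, and let $n\in \mathbb{F}[x]\setminus\{0\}$. Let $A\subset \mathbb{F}[x]$ be a Diophantine tuple with property $D_k(n)$. If $n=s^2$ for some $s\in \mathbb{F}[x]$ and $n$ is a $k$-th power in $\mathbb{F}[x]$, assume additionally that $A\not\subset s\mathbb{F}:=\{cs:c\in\mathbb{F}\}$. Then $|A|\leq 6$. Moreover, if $n$ is nonsquare (i.e. not the square of an element of $\mathbb{F}[x]$) and $k$ is even, then $|A|\leq 5$.
   Context: A set $A\subset \mathbb{F}[x]$ is called a Diophantine tuple with property $D_k(n)$ if $ab+n$ is a $k$-th power in $\mathbb{F}[x]$ for all distinct $a,b\in A$. The zero polynomial is regarded as a $k$-th power. *)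

theory Defs
  imports "HOL-Computational_Algebra.Computational_Algebra"
begin

definition diophantine_tuple :: "nat \<Rightarrow> 'a :: field poly \<Rightarrow> 'a poly set \<Rightarrow> bool" where
  "diophantine_tuple k n A \<longleftrightarrow>
     (\<forall>a\<in>A. \<forall>b\<in>A. a \<noteq> b \<longrightarrow> is_nth_power k (a * b + n))"

end

(* If s_i and t_j are distinct elements of A with s_i != t_j, the matrix s_i t_j + n has rank at
   most 2, so each of its 3 x 3 determinants gives a relation between six k-th powers that does
   not involve n. A truncated Mason-Stothers inequality, proved with a Wronskian of five of the
   six terms, shows for k >= 18 that a minimal linear relation over the field between such powers
   has only two terms. Hence the six terms fall into classes of constant multiples with vanishing
   sums, and comparing orders of vanishing at each point puts them all into one class. The same
   argument for the relation between the three minors of two columns then makes all entries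
   constant multiples of each other, so n is a constant multiple of s_i t_j, and s_1, s_2 are
   constant multiples of each other. It remains to choose the rows and columns
   so that no entry vanishes: the vanishing entries s t + n = 0 form a matching on A. *)
theory Submission
  imports "Jordan_Normal_Form.Determinant" Defs
begin

hide_const (open) Module.smult

section \<open>Wronskians\<close>

text \<open>The exponent is governed by losses of order at a point \<open>r\<close>. If every
  vanishing term of a minimal relation with \<open>d + 1\<close> terms is charged the full
  \<open>d - 1\<close> derivatives, an order \<open>e\<close> can afford this when d * e \<le> (d +
  1) * (e - (d - 1)), that is e \<ge> d^2 - 1. This is 15 for five terms but 24 for six, so for k =
  18 a full six-term relation is out of reach of that estimate. What rescues it is a second
  identity: the three even and the three odd terms of a 3 x 3 determinant have the same product,
  since each product contains every entry once. Hence the orders at \<open>r\<close> balance between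
  the two sides, and the critical case is one vanishing term on each side. A proper subrelation
  loses the balance, but has at most five terms.

  The balance is used again after sorting the terms into classes, because vanishing class sums alone
  would allow several classes. Orders carry no information at a zero entry, so the number of zeros
  to be avoided decides between 6 and 5.\<close>

definition wronskian :: "nat \<Rightarrow> (nat \<Rightarrow> 'a :: idom poly) \<Rightarrow> 'a poly" where
  "wronskian d f = det (mat d d (\<lambda>(i, j). (pderiv ^^ j) (f i)))"

definition lin_indep :: "nat \<Rightarrow> (nat \<Rightarrow> 'a :: idom poly) \<Rightarrow> bool" where
  "lin_indep d f \<longleftrightarrow> (\<forall>c. (\<Sum>i<d. smult (c i) (f i)) = 0 \<longrightarrow> (\<forall>i<d. c i = 0))"

text \<open>The quotient of \<open>p\<close> and \<open>q\<close> has derivative zero. Without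
  fractions: in characteristic 0, comparing leading coefficients shows that every nonzero solution
  has the degree of \<open>q\<close>. Solutions form a linear space, so subtracting the multiple of
  \<open>q\<close> that cancels the top coefficient leaves zero.\<close>

lemma proportional_if_wronskian2_zero:
  fixes p q :: "'a :: field_char_0 poly"
  assumes "pderiv p * q = p * pderiv q" "q \<noteq> 0"
  shows "\<exists>c. p = smult c q"
proof -
  have deg: "degree u = degree q" if "pderiv u * q = u * pderiv q" "u \<noteq> 0" for u
  proof (cases "degree u = 0 \<or> degree q = 0")
    case True
    have *: "pderiv u = 0 \<longleftrightarrow> pderiv q = 0"
      using that \<open>q \<noteq> 0\<close> by (metis mult_eq_0_iff)
    then show ?thesis using True by (auto simp: pderiv_eq_0_iff)
  next
    case False
    have "lead_coeff (pderiv u * q) = lead_coeff (u * pderiv q)"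
      using that by simp
    moreover have "lead_coeff (pderiv v) = of_nat (degree v) * lead_coeff v" if "degree v \<noteq> 0"
      for v :: "'a poly"
      using that by (simp add: degree_pderiv coeff_pderiv)
    ultimately have "of_nat (degree u) * (lead_coeff u * lead_coeff q) =
        of_nat (degree q) * (lead_coeff u * lead_coeff q)"
      using False by (simp add: lead_coeff_mult ac_simps)
    then show ?thesis
      using \<open>q \<noteq> 0\<close> \<open>u \<noteq> 0\<close> by simp
  qed
  show ?thesis
  proof (cases "p = 0")
    case True
    then have "p = smult 0 q" by simp
    then show ?thesis by blast
  next
    case False
    define c where "c = lead_coeff p / lead_coeff q"
    define u where "u = p - smult c q"
    have dp: "degree p = degree q" using deg assms False by blast
    have "u = 0"
    proof (rule ccontr)
      assume "u \<noteq> 0"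
      moreover have "pderiv u * q = u * pderiv q"
        using assms by (simp add: u_def pderiv_diff pderiv_smult algebra_simps)
      ultimately have du: "degree u = degree q" using deg by blast
      moreover have "coeff u (degree q) = 0"
        using dp \<open>q \<noteq> 0\<close> by (simp add: u_def c_def)
      ultimately show False using \<open>u \<noteq> 0\<close> by (metis leading_coeff_0_iff)
    qed
    then show ?thesis unfolding u_def by auto
  qed
qed

lemma wronskian_nonzeroD:
  assumes "wronskian d f \<noteq> 0"
    and "\<And>j. j < d \<Longrightarrow> (\<Sum>i<d. v i * (pderiv ^^ j) (f i)) = 0"
    and "i < d"
  shows "v i = 0"
proof (rule ccontr)
  assume "v i \<noteq> 0"
  let ?A = "mat d d (\<lambda>(i, j). (pderiv ^^ j) (f i))"
  have "det (transpose_mat ?A) = 0"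
  proof (subst det_0_iff_vec_prod_zero)
    show "transpose_mat ?A \<in> carrier_mat d d" by simp
    have "vec d v \<noteq> 0\<^sub>v d"
      using \<open>v i \<noteq> 0\<close> \<open>i < d\<close> by (metis index_vec index_zero_vec(1))
    moreover have "transpose_mat ?A *\<^sub>v vec d v = 0\<^sub>v d"
    proof (rule eq_vecI)
      fix j assume "j < dim_vec (0\<^sub>v d :: 'a poly vec)"
      then have "j < d" by simp
      have "(transpose_mat ?A *\<^sub>v vec d v) $ j = (\<Sum>i<d. v i * (pderiv ^^ j) (f i))"
        using \<open>j < d\<close> by (simp add: scalar_prod_def lessThan_atLeast0 mult.commute)
      then show "(transpose_mat ?A *\<^sub>v vec d v) $ j = 0\<^sub>v d $ j"
        using assms(2) \<open>j < d\<close> by simp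
    qed simp
    ultimately show "\<exists>v. v \<in> carrier_vec d \<and> v \<noteq> 0\<^sub>v d \<and> transpose_mat ?A *\<^sub>v v = 0\<^sub>v d"
      by (intro exI[of _ "vec d v"]) simp
  qed
  then show False using assms(1) by (simp add: wronskian_def det_transpose[of _ d])
qed

lemma wronskian_zeroE:
  assumes "wronskian d f = 0"
  obtains v where "\<And>j. j < d \<Longrightarrow> (\<Sum>i<d. v i * (pderiv ^^ j) (f i)) = 0" "\<exists>i<d. v i \<noteq> 0"
proof -
  let ?A = "mat d d (\<lambda>(i, j). (pderiv ^^ j) (f i))"
  have "det (transpose_mat ?A) = 0"
    using assms by (simp add: wronskian_def det_transpose[of _ d])
  then obtain w where w: "w \<in> carrier_vec d" "w \<noteq> 0\<^sub>v d" "transpose_mat ?A *\<^sub>v w = 0\<^sub>v d"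
    by (subst (asm) det_0_iff_vec_prod_zero[of _ d]) auto
  show ?thesis
  proof (rule that[of "\<lambda>i. w $ i"])
    fix j assume "j < d"
    have "(transpose_mat ?A *\<^sub>v w) $ j = (\<Sum>i<d. w $ i * (pderiv ^^ j) (f i))"
      using \<open>j < d\<close> w(1) by (simp add: scalar_prod_def lessThan_atLeast0 mult.commute)
    then show "(\<Sum>i<d. w $ i * (pderiv ^^ j) (f i)) = 0"
      using w(3) \<open>j < d\<close> by simp
  next
    show "\<exists>i<d. w $ i \<noteq> 0"
      using w(1,2) by (metis carrier_vecD eq_vecI index_zero_vec)
  qed
qed

lemma lin_indep_lessI: "lin_indep (Suc d) f \<Longrightarrow> lin_indep d f"
  unfolding lin_indep_def
proof (intro allI impI)
  fix c i
  assume *: "\<forall>c. (\<Sum>i<Suc d. smult (c i) (f i)) = 0 \<longrightarrow> (\<forall>i<Suc d. c i = 0)"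
    and "(\<Sum>i<d. smult (c i) (f i)) = 0" "i < d"
  then have "(\<Sum>i<Suc d. smult ((c(d := 0)) i) (f i)) = 0" by simp
  then show "c i = 0" using *[rule_format, of "c(d := 0)" i] \<open>i < d\<close> by simp
qed

text \<open>A vanishing determinant gives a relation \<open>v\<close> between the rows with
  polynomial coefficients. By the induction hypothesis \<open>v d\<close> is nonzero; dividing by it
  and differentiating leaves a relation between only \<open>d\<close> rows, so the quotients of
  \<open>v i\<close> by \<open>v d\<close> have derivative zero and the relation is one over the
  constants.\<close>

lemma wronskian_nonzero:
  fixes f :: "nat \<Rightarrow> 'a :: field_char_0 poly"
  assumes "lin_indep d f"
  shows "wronskian d f \<noteq> 0"
  using assms
proof (induction d)
  case 0
  then show ?case by (simp add: wronskian_def)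
next
  case (Suc d)
  have IH: "wronskian d f \<noteq> 0" using Suc lin_indep_lessI by blast
  show ?case
  proof
    assume "wronskian (Suc d) f = 0"
    then obtain v where v: "\<And>j. j < Suc d \<Longrightarrow> (\<Sum>i<Suc d. v i * (pderiv ^^ j) (f i)) = 0"
      and nz: "\<exists>i<Suc d. v i \<noteq> 0" by (rule wronskian_zeroE) blast
    have vd: "v d \<noteq> 0"
    proof
      assume "v d = 0"
      have "v i = 0" if "i < d" for i
      proof (rule wronskian_nonzeroD[OF IH _ that, where v = v])
        fix j assume "j < d"
        then show "(\<Sum>i<d. v i * (pderiv ^^ j) (f i)) = 0"
          using v[of j] \<open>v d = 0\<close> by simp
      qed
      with \<open>v d = 0\<close> nz show False by (metis less_SucE)
    qed
    \<comment> \<open>Differentiating relation \<open>j\<close> yields relation \<open>j + 1\<close>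
      plus the relation with coefficients \<open>pderiv (v i)\<close>; this uses up one column,
      hence \<open>j < d\<close>.\<close>
    have der: "(\<Sum>i<Suc d. pderiv (v i) * (pderiv ^^ j) (f i)) = 0" if "j < d" for j
    proof -
      have "0 = pderiv (\<Sum>i<Suc d. v i * (pderiv ^^ j) (f i))"
        using v[of j] that by simp
      also have "\<dots> = (\<Sum>i<Suc d. v i * (pderiv ^^ Suc j) (f i)) + (\<Sum>i<Suc d. pderiv (v i) * (pderiv ^^ j) (f i))"
        by (simp only: higher_pderiv_sum[of 1, simplified] pderiv_mult sum.distrib[symmetric])
          (simp add: mult.commute)
      finally show ?thesis using v[of "Suc j"] that by simp
    qed
    have "pderiv (v i) * v d = v i * pderiv (v d)" if "i < d" for i
    proof -
      \<comment> \<open>The numerator of the derivative of the quotient. It is zero for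
        \<open>i = d\<close>, so these coefficients form a relation between the first
        \<open>d\<close> rows.\<close>
      have "pderiv (v i) * v d - v i * pderiv (v d) = 0"
      proof (rule wronskian_nonzeroD[OF IH _ that])
        fix j assume "j < d"
        have "(\<Sum>i<d. (pderiv (v i) * v d - v i * pderiv (v d)) * (pderiv ^^ j) (f i)) =
            (\<Sum>i<Suc d. (pderiv (v i) * v d - v i * pderiv (v d)) * (pderiv ^^ j) (f i))"
          by simp
        also have "\<dots> = v d * (\<Sum>i<Suc d. pderiv (v i) * (pderiv ^^ j) (f i)) -
            pderiv (v d) * (\<Sum>i<Suc d. v i * (pderiv ^^ j) (f i))"
          by (simp only: sum_distrib_left sum_subtractf[symmetric]) (simp add: algebra_simps)
        also have "\<dots> = 0" using v[of j] der[of j] \<open>j < d\<close> by simp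
        finally show "(\<Sum>i<d. (pderiv (v i) * v d - v i * pderiv (v d)) * (pderiv ^^ j) (f i)) = 0" .
      qed
      then show ?thesis by simp
    qed
    then have "\<exists>c. v i = smult c (v d)" if "i < Suc d" for i
    proof (cases "i = d")
      case True
      then have "v i = smult 1 (v d)" by simp
      then show ?thesis by blast
    next
      case False
      then show ?thesis
        using that \<open>\<And>i. i < d \<Longrightarrow> pderiv (v i) * v d = v i * pderiv (v d)\<close> vd
        by (intro proportional_if_wronskian2_zero) auto
    qed
    then have "\<forall>i. \<exists>c. i < Suc d \<longrightarrow> v i = smult c (v d)" by blast
    from choice[OF this] obtain c where c: "\<And>i. i < Suc d \<Longrightarrow> v i = smult (c i) (v d)" by blast
    have "v d * (\<Sum>i<Suc d. smult (c i) (f i)) = (\<Sum>i<Suc d. v i * f i)"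
    proof -
      have eq: "v d * smult (c i) (f i) = v i * f i" if "i < Suc d" for i
        using arg_cong[OF c[OF that], of "\<lambda>x. x * f i"]
        by (simp only: mult_smult_left mult_smult_right)
      show ?thesis
        unfolding sum_distrib_left by (rule sum.cong) (simp_all only: lessThan_iff eq)
    qed
    also have "\<dots> = 0" using v[of 0] by simp
    finally have "(\<Sum>i<Suc d. smult (c i) (f i)) = 0" using vd by (simp only: mult_eq_0_iff) simp
    then have "c d = 0" using Suc.prems unfolding lin_indep_def by blast
    moreover have "v d = smult (c d) (v d)" by (rule c) simp
    ultimately show False using vd by (metis smult_0_left)
  qed
qed

text \<open>Constants commute with \<open>pderiv\<close>, so the base change multiplies the whole
  Wronskian matrix and contributes its determinant. Each point and each degree estimate can then use
  the basis that suits it best.\<close>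

lemma wronskian_change_basis:
  fixes f g :: "nat \<Rightarrow> 'a :: field_char_0 poly"
  assumes "\<And>i. i < d \<Longrightarrow> \<exists>c. g i = (\<Sum>j<d. smult (c j) (f j))" and "lin_indep d g"
  shows "\<exists>c. c \<noteq> 0 \<and> wronskian d g = smult c (wronskian d f)"
proof -
  obtain C where C: "\<And>i. i < d \<Longrightarrow> g i = (\<Sum>j<d. smult (C i j) (f j))"
    using assms(1) by metis
  interpret cp: comm_ring_hom "\<lambda>c :: 'a. [:c:]"
    by standard (auto simp: one_pCons)
  let ?M = "\<lambda>f :: nat \<Rightarrow> 'a poly. mat d d (\<lambda>(i, j). (pderiv ^^ j) (f i))"
  let ?C = "mat d d (\<lambda>(i, j). C i j)"
  have "?M g = map_mat (\<lambda>c. [:c:]) ?C * ?M f"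
    by (rule eq_matI)
      (auto simp: C scalar_prod_def higher_pderiv_sum higher_pderiv_smult lessThan_atLeast0)
  then have "wronskian d g = [:det ?C:] * wronskian d f"
    by (simp add: wronskian_def det_mult[of _ d])
  moreover have "wronskian d g \<noteq> 0" using assms(2) by (rule wronskian_nonzero)
  ultimately show ?thesis
    by (intro exI[of _ "det ?C"]) auto
qed

section \<open>Degrees and vanishing orders of Wronskians\<close>

lemma wronskian_expand:
  "wronskian d f = (\<Sum>p\<in>{p. p permutes {..<d}}. signof p * (\<Prod>i<d. (pderiv ^^ p i) (f i)))"
proof -
  have "wronskian d f = (\<Sum>p\<in>{p. p permutes {0..<d}}. signof p * (\<Prod>i=0..<d. 
    mat d d (\<lambda>(i, j). (pderiv ^^ j) (f i)) $$ (i, p i)))"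
    unfolding wronskian_def by (rule det_def') simp
  also have "\<dots> = (\<Sum>p\<in>{p. p permutes {0..<d}}. signof p * (\<Prod>i=0..<d. (pderiv ^^ p i) (f i)))"
    by (intro sum.cong refl arg_cong2[of _ _ _ _ "(*)"] prod.cong) (auto dest: permutes_in_image)
  finally show ?thesis by (simp add: lessThan_atLeast0)
qed

lemma sum_permutes_id:
  fixes p :: "nat \<Rightarrow> nat"
  assumes "p permutes {..<d}"
  shows "(\<Sum>i<d. p i) = d * (d - 1) div 2"
proof -
  have "(\<Sum>i<d. p i) = (\<Sum>i<d. i)"
    using sum.permute[OF assms, of "\<lambda>x. x"] by (simp add: o_def)
  also have "\<dots> = d * (d - 1) div 2"
    by (simp add: lessThan_atLeast0 Sum_Ico_nat)
  finally show ?thesis .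
qed

text \<open>In each term of the Leibniz expansion the orders of differentiation are a permutation of
  0, ..., d - 1, so a nonzero term loses exactly their sum.\<close>

lemma degree_wronskian_le:
  fixes f :: "nat \<Rightarrow> 'a :: field_char_0 poly"
  assumes "wronskian d f \<noteq> 0"
  shows "degree (wronskian d f) + d * (d - 1) div 2 \<le> (\<Sum>i<d. degree (f i))"
proof -
  let ?t = "\<lambda>p. (\<Prod>i<d. (pderiv ^^ p i) (f i))"
  have *: "degree (?t p) + d * (d - 1) div 2 \<le> (\<Sum>i<d. degree (f i))"
    if "p permutes {..<d}" "?t p \<noteq> 0" for p
  proof -
    have "p i \<le> degree (f i)" if "i < d" for i
    proof (rule ccontr)
      assume "\<not> p i \<le> degree (f i)"
      then obtain m where m: "p i = Suc (degree (f i) + m)"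
        by (metis add_Suc_right less_imp_Suc_add not_le)
      have "pderiv ((pderiv ^^ (degree (f i) + m)) (f i)) = 0"
        by (subst pderiv_eq_0_iff) (simp add: degree_higher_pderiv)
      then have "(pderiv ^^ p i) (f i) = 0" unfolding m by simp
      then show False using \<open>?t p \<noteq> 0\<close> that by auto
    qed
    then have "(\<Sum>i<d. degree (f i)) = (\<Sum>i<d. (degree (f i) - p i) + p i)"
      by (intro sum.cong) auto
    also have "\<dots> = (\<Sum>i<d. degree ((pderiv ^^ p i) (f i))) + d * (d - 1) div 2"
      by (simp add: sum.distrib degree_higher_pderiv sum_permutes_id[OF that(1)])
    finally show ?thesis
      using degree_prod_sum_le[of "{..<d}" "\<lambda>i. (pderiv ^^ p i) (f i)"] by (simp add: o_def)
  qed
  \<comment> \<open>A nonzero term shows that the total degree is at least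
    \<open>d * (d - 1) div 2\<close>, so the subtraction below is not truncated.\<close>
  obtain p0 where "p0 permutes {..<d}" "?t p0 \<noteq> 0"
    using assms unfolding wronskian_expand by (metis (no_types, lifting) mem_Collect_eq mult_not_zero sum.neutral)
  then have "d * (d - 1) div 2 \<le> (\<Sum>i<d. degree (f i))" using *[of p0] by simp
  moreover have "degree (wronskian d f) \<le> (\<Sum>i<d. degree (f i)) - d * (d - 1) div 2"
    unfolding wronskian_expand
  proof (rule degree_sum_le)
    show "finite {p. p permutes {..<d}}" by (simp add: finite_permutations)
    fix p assume "p \<in> {p. p permutes {..<d}}"
    then have "degree (?t p) \<le> (\<Sum>i<d. degree (f i)) - d * (d - 1) div 2"
    proof (cases "?t p = 0")
      case True
      then show ?thesis by (simp only: degree_0)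
    next
      case False
      then show ?thesis using *[of p] \<open>p \<in> _\<close> by simp
    qed
    then show "degree (signof p * ?t p) \<le> (\<Sum>i<d. degree (f i)) - d * (d - 1) div 2"
      by (cases p rule: sign_cases) auto
  qed
  ultimately show ?thesis by simp
qed

lemma power_dvd_higher_pderiv:
  fixes p :: "'a :: idom poly"
  assumes "q ^ e dvd p"
  shows "q ^ (e - j) dvd (pderiv ^^ j) p"
proof (induction j)
  case (Suc j)
  then obtain s where s: "(pderiv ^^ j) p = q ^ (e - j) * s" by (elim dvdE)
  show ?case
  proof (cases "e - j")
    case 0
    then show ?thesis by simp
  next
    case (Suc m)
    then have "e - Suc j = m" by simp
    have "pderiv (q ^ Suc m * s) = q ^ m * (q * pderiv s + smult (of_nat (Suc m)) (pderiv q) * s)"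
      by (simp only: pderiv_mult pderiv_power_Suc) (simp add: algebra_simps)
    then show ?thesis using s Suc \<open>e - Suc j = m\<close> by simp
  qed
qed (use assms in simp)

text \<open>\<open>N\<close> is a lower bound over all permutations because the local estimates
  account for the derivatives differently: per row, in total, or over two rows. The truncated
  \<open>e i - p i\<close> costs nothing on rows that do not vanish.\<close>

lemma power_dvd_wronskian:
  fixes f :: "nat \<Rightarrow> 'a :: idom poly"
  assumes "\<And>i. i < d \<Longrightarrow> q ^ e i dvd f i"
    and "\<And>p. p permutes {..<d} \<Longrightarrow> N \<le> (\<Sum>i<d. e i - p i)"
  shows "q ^ N dvd wronskian d f"
  unfolding wronskian_expand
proof (rule dvd_sum)
  fix p assume p: "p \<in> {p. p permutes {..<d}}"
  have "(\<Prod>i<d. q ^ (e i - p i)) dvd (\<Prod>i<d. (pderiv ^^ p i) (f i))"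
    using assms(1) by (intro prod_dvd_prod power_dvd_higher_pderiv) auto
  then have "q ^ (\<Sum>i<d. e i - p i) dvd (\<Prod>i<d. (pderiv ^^ p i) (f i))"
    by (simp add: power_sum)
  then have "q ^ N dvd (\<Prod>i<d. (pderiv ^^ p i) (f i))"
    using assms(2)[of p] p le_imp_power_dvd by (metis dvd_trans mem_Collect_eq)
  then show "q ^ N dvd signof p * (\<Prod>i<d. (pderiv ^^ p i) (f i))" by simp
qed

text \<open>Common roots are divided out one at a time; algebraic closure supplies them until
  \<open>p\<close> is constant.\<close>

lemma dvd_if_order_le:
  fixes p q :: "'a :: alg_closed_field poly"
  assumes "p \<noteq> 0" "\<And>r. order r p \<le> order r q"
  shows "p dvd q"
  using assms
proof (induction "degree p" arbitrary: p q)
  case 0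
  then show ?case by (metis is_unit_iff_degree unit_imp_dvd)
next
  case (Suc d)
  show ?case
  proof (cases "q = 0")
    case False
    obtain r where r: "poly p r = 0"
      using Suc.hyps alg_closed_imp_poly_has_root[of p] by auto
    then obtain p' where p': "p = [:-r, 1:] * p'" by (metis poly_eq_0_iff_dvd dvdE)
    have "poly q r = 0"
      using r Suc.prems(1) Suc.prems(2)[of r] by (metis order_root le_zero_eq)
    then obtain q' where q': "q = [:-r, 1:] * q'" by (metis poly_eq_0_iff_dvd dvdE)
    have "p' \<noteq> 0" "q' \<noteq> 0" using p' q' Suc.prems False by auto
    have "p' dvd q'"
    proof (rule Suc.hyps(1))
      show "d = degree p'" using Suc.hyps(2) p' \<open>p' \<noteq> 0\<close> by (simp add: degree_mult_eq del: mult_pCons_left)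
      show "p' \<noteq> 0" by fact
      fix s
      show "order s p' \<le> order s q'"
        using Suc.prems(2)[of s] Suc.prems(1) False unfolding p' q'
        by (simp add: order_mult del: mult_pCons_left)
    qed
    then show ?thesis unfolding p' q' by (simp del: mult_pCons_left)
  qed simp
qed

section \<open>Minimal linear relations\<close>

text \<open>A circuit of the linear matroid of the family: by the second clause a nontrivial
  relation uses every index. Since the family is indexed, two equal nonzero polynomials form a
  circuit of two elements.\<close>

definition circuit :: "'i set \<Rightarrow> ('i \<Rightarrow> 'a :: idom poly) \<Rightarrow> bool" where
  "circuit J u \<longleftrightarrow> (\<exists>c. (\<Sum>i\<in>J. smult (c i) (u i)) = 0 \<and> (\<exists>i\<in>J. c i \<noteq> 0)) \<and>
     (\<forall>c. (\<Sum>i\<in>J. smult (c i) (u i)) = 0 \<longrightarrow> (\<exists>i\<in>J. c i = 0) \<longrightarrow> (\<forall>i\<in>J. c i = 0))"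

text \<open>Exchanging \<open>j\<close> with the last index makes \<open>i < d\<close> run through
  all members except \<open>f j\<close>.\<close>

lemma circuit_lin_indep:
  assumes "circuit {..d} f" "j \<le> d"
  shows "lin_indep d (f \<circ> transpose j d)"
  unfolding lin_indep_def
proof (intro allI impI)
  fix b i
  let ?t = "transpose j d"
  assume b: "(\<Sum>i<d. smult (b i) ((f \<circ> ?t) i)) = 0" and "i < d"
  define c where "c = (\<lambda>i. if i = j then 0 else b (?t i))"
  have t: "?t permutes {..d}" using assms(2) by (simp add: permutes_swap_id)
  have ne: "?t i \<noteq> j" if "i < d" for i
    using that assms(2) by (auto simp: transpose_eq_iff)
  have "(\<Sum>i\<le>d. smult (c i) (f i)) = (\<Sum>i\<le>d. smult (c (?t i)) (f (?t i)))"
    using sum.permute[OF t, of "\<lambda>i. smult (c i) (f i)"] by (simp add: o_def)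
  also have "\<dots> = (\<Sum>i<d. smult (c (?t i)) (f (?t i)))"
    by (simp add: lessThan_Suc_atMost[symmetric] c_def)
  also have "\<dots> = (\<Sum>i<d. smult (b i) ((f \<circ> ?t) i))"
    by (rule sum.cong) (auto simp: c_def ne)
  finally have "(\<Sum>i\<le>d. smult (c i) (f i)) = 0" using b by simp
  moreover have "\<exists>i\<in>{..d}. c i = 0" using assms(2) by (auto simp: c_def)
  ultimately have "\<forall>i\<in>{..d}. c i = 0" using assms(1) unfolding circuit_def by blast
  moreover have "?t i \<le> d" using t \<open>i < d\<close> permutes_in_image[OF t, of i] by simp
  ultimately have "c (?t i) = 0" by simp
  then show "b i = 0" using ne[OF \<open>i < d\<close>] by (simp add: c_def)
qed

lemma smult_sum_right: "smult c (sum f J) = (\<Sum>i\<in>J. smult c (f i))"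
  by (induction J rule: infinite_finite_induct) (auto simp: smult_add_right)

lemma circuit_span:
  fixes f :: "nat \<Rightarrow> 'a :: field poly"
  assumes "circuit {..d} f" "\<exists>c. g = (\<Sum>j\<le>d. smult (c j) (f j))"
  shows "\<exists>c. g = (\<Sum>j<d. smult (c j) (f j))"
proof -
  obtain c where c: "(\<Sum>i\<le>d. smult (c i) (f i)) = 0" "\<exists>i\<in>{..d}. c i \<noteq> 0"
    using assms(1) unfolding circuit_def by blast
  then have cd: "c d \<noteq> 0" using assms(1) unfolding circuit_def by blast
  have "smult (c d) (f d) = - (\<Sum>i<d. smult (c i) (f i))"
    using c(1) by (simp add: lessThan_Suc_atMost[symmetric] eq_neg_iff_add_eq_0 add.commute)
  then have "smult (inverse (c d)) (smult (c d) (f d)) = smult (inverse (c d)) (- (\<Sum>i<d. smult (c i) (f i)))"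
    by simp
  then have fd: "f d = (\<Sum>i<d. smult (- inverse (c d) * c i) (f i))"
    using cd by (simp add: smult_sum_right sum_negf)
  obtain a where "g = (\<Sum>j\<le>d. smult (a j) (f j))" using assms(2) by blast
  also have "\<dots> = (\<Sum>j<d. smult (a j) (f j)) + smult (a d) (f d)"
    by (simp add: lessThan_Suc_atMost[symmetric])
  also have "\<dots> = (\<Sum>j<d. smult (a j + a d * (- inverse (c d) * c j)) (f j))"
    by (subst fd) (simp add: smult_sum_right sum.distrib smult_diff_left sum_subtractf sum_negf)
  finally show ?thesis
    by (intro exI[of _ "\<lambda>j. a j + a d * (- inverse (c d) * c j)"])
qed

lemma in_span: "j \<le> d \<Longrightarrow> \<exists>c. f j = (\<Sum>i\<le>d. smult (c i) (f i))"
  for f :: "nat \<Rightarrow> 'a :: idom poly"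
  by (rule exI[of _ "\<lambda>i. if i = j then 1 else 0"]) (simp add: if_distrib[of "\<lambda>c. smult c _"] cong: if_cong)

lemma transpose_le: "j \<le> d \<Longrightarrow> i < d \<Longrightarrow> transpose j d i \<le> d"
  for d :: nat
  by (simp add: transpose_def)

lemma sum_transpose:
  fixes h :: "nat \<Rightarrow> 'b :: comm_monoid_add"
  assumes "j \<le> d"
  shows "(\<Sum>i<d. h (transpose j d i)) + h j = (\<Sum>i\<le>d. h i)"
proof -
  have "transpose j d permutes {..d}" using assms by (simp add: permutes_swap_id)
  from sum.permute[OF this, of h] show ?thesis
    by (simp add: lessThan_Suc_atMost[symmetric])
qed

lemma order_prod:
  fixes f :: "'i \<Rightarrow> 'a :: idom poly"
  assumes "finite J" "\<And>i. i \<in> J \<Longrightarrow> f i \<noteq> 0"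
  shows "order r (prod f J) = (\<Sum>i\<in>J. order r (f i))"
  using assms by (induction rule: finite_induct) (auto simp: order_mult)

lemma order_power: "p \<noteq> 0 \<Longrightarrow> order r (p ^ m) = m * order r p"
  for p :: "'a :: idom poly"
  by (induction m) (auto simp: order_mult)

text \<open>Comparing degrees: omitting each index in turn, \<open>d + 1\<close> times the degree bound for
  the Wronskian falls short of \<open>d\<close> times the total degree.\<close>

lemma circuit_wronskian_order:
  fixes f :: "nat \<Rightarrow> 'a :: {alg_closed_field, field_char_0} poly"
  assumes d: "2 \<le> d" and nz: "\<And>i. i \<le> d \<Longrightarrow> f i \<noteq> 0" and circ: "circuit {..d} f"
    and loc: "\<And>r. \<exists>g N. lin_indep d g \<and> (\<forall>i<d. \<exists>c. g i = (\<Sum>j\<le>d. smult (c j) (f j))) \<and>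
      [:-r, 1:] ^ N dvd wronskian d g \<and> d * (\<Sum>i\<le>d. order r (f i)) \<le> Suc d * N"
  shows False
proof -
  let ?W = "wronskian d f"
  \<comment> \<open>Any independent choice from the span has the same Wronskian up to a constant, so
    orders and degrees of \<open>?W\<close> may be read off any of them.\<close>
  have W: "\<exists>c. c \<noteq> 0 \<and> wronskian d g = smult c ?W"
    if "lin_indep d g" "\<forall>i<d. \<exists>c. g i = (\<Sum>j\<le>d. smult (c j) (f j))" for g
    using wronskian_change_basis[of d g f] that circuit_span[OF circ] by blast
  have W0: "?W \<noteq> 0"
    using wronskian_nonzero circuit_lin_indep[OF circ, of d] by (simp add: o_def)
  let ?S = "\<Sum>i\<le>d. degree (f i)"
  have P0: "prod f {..d} \<noteq> 0" using nz by simp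
  \<comment> \<open>At each point this is the inequality supplied by \<open>loc\<close>; as a
    divisibility it becomes one comparison of degrees.\<close>
  have "prod f {..d} ^ d dvd ?W ^ Suc d"
  proof (rule dvd_if_order_le)
    fix r
    obtain g N where gN: "lin_indep d g" "\<forall>i<d. \<exists>c. g i = (\<Sum>j\<le>d. smult (c j) (f j))"
      "[:-r, 1:] ^ N dvd wronskian d g" "d * (\<Sum>i\<le>d. order r (f i)) \<le> Suc d * N"
      using loc[of r] by blast
    have "N \<le> order r ?W"
      using W[OF gN(1,2)] gN(3) W0 by (metis order_divides order_smult smult_eq_0_iff)
    then have "Suc d * N \<le> Suc d * order r ?W" by (rule mult_le_mono2)
    with gN(4) have "d * (\<Sum>i\<le>d. order r (f i)) \<le> Suc d * order r ?W" by linarith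
    moreover have "order r (prod f {..d}) = (\<Sum>i\<le>d. order r (f i))"
      using nz by (intro order_prod) auto
    ultimately show "order r (prod f {..d} ^ d) \<le> order r (?W ^ Suc d)"
      by (simp only: order_power[OF W0] order_power[OF P0])
  qed (use P0 in simp)
  then have "degree (prod f {..d} ^ d) \<le> degree (?W ^ Suc d)"
    using W0 by (intro dvd_imp_degree_le) auto
  then have 1: "d * ?S \<le> Suc d * degree ?W"
    using nz W0 P0 by (simp add: degree_power_eq degree_prod_eq_sum_degree del: power_Suc)
  have "degree ?W + d * (d - 1) div 2 + degree (f j) \<le> ?S" if "j \<le> d" for j
  proof -
    let ?g = "f \<circ> transpose j d"
    have li: "lin_indep d ?g" using circ that by (rule circuit_lin_indep)
    have "\<forall>i<d. \<exists>c. ?g i = (\<Sum>j\<le>d. smult (c j) (f j))"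
    proof (intro allI impI)
      fix i assume "i < d"
      then show "\<exists>c. ?g i = (\<Sum>j\<le>d. smult (c j) (f j))"
        using in_span[OF transpose_le[OF that], of i f] by simp
    qed
    with W[OF li] have "degree (wronskian d ?g) = degree ?W" by auto
    moreover have "degree (wronskian d ?g) + d * (d - 1) div 2 \<le> (\<Sum>i<d. degree (?g i))"
      using degree_wronskian_le wronskian_nonzero[OF li] by blast
    ultimately show ?thesis
      using sum_transpose[OF that, of "\<lambda>i. degree (f i)"] by simp
  qed
  then have "(\<Sum>j\<le>d. degree ?W + d * (d - 1) div 2 + degree (f j)) \<le> (\<Sum>j\<le>d. ?S)"
    by (intro sum_mono) simp
  then have "Suc d * (degree ?W + d * (d - 1) div 2) + ?S \<le> Suc d * ?S"
    by (simp only: sum.distrib sum_constant card_atMost of_nat_id) (simp add: algebra_simps)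
  then have "Suc d * degree ?W + Suc d * (d * (d - 1) div 2) \<le> d * ?S" by (simp add: algebra_simps)
  \<comment> \<open>The contradiction comes from the degree lost by differentiating, which is
    positive because \<open>d\<close> is at least 2.\<close>
  moreover have "2 * 1 \<le> d * (d - 1)" using d by (intro mult_le_mono) auto
  then have "Suc d * (d * (d - 1) div 2) > 0" by (simp add: div_greater_zero_iff)
  ultimately show False using 1 by linarith
qed

text \<open>The bound 15 is \<open>d^2 - 1\<close> at \<open>d = 4\<close>, the order from which
  every row can afford to lose \<open>d - 1\<close>. Leaving out the nonvanishing \<open>f j\<close>
  keeps the full sum of orders.\<close>

lemma circuit_local_low:
  fixes f :: "nat \<Rightarrow> 'a :: field_char_0 poly"
  assumes "2 \<le> d" "d \<le> 4" "circuit {..d} f" "j \<le> d" "order r (f j) = 0"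
    and o: "\<And>i. i \<le> d \<Longrightarrow> order r (f i) = 0 \<or> order r (f i) \<ge> 15"
  shows "\<exists>g N. lin_indep d g \<and> (\<forall>i<d. \<exists>c. g i = (\<Sum>j\<le>d. smult (c j) (f j))) \<and>
      [:-r, 1:] ^ N dvd wronskian d g \<and> d * (\<Sum>i\<le>d. order r (f i)) \<le> Suc d * N"
proof -
  let ?g = "f \<circ> transpose j d"
  let ?e = "\<lambda>i. order r (?g i)"
  let ?N = "\<Sum>i<d. ?e i - (d - 1)"
  have 1: "lin_indep d ?g" using assms by (intro circuit_lin_indep)
  have 2: "\<exists>c. ?g i = (\<Sum>j\<le>d. smult (c j) (f j))" if "i < d" for i
    using in_span[OF transpose_le[OF \<open>j \<le> d\<close> that]] by simp
  have 3: "[:-r, 1:] ^ ?N dvd wronskian d ?g"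
  proof (rule power_dvd_wronskian)
    show "[:-r, 1:] ^ ?e i dvd ?g i" for i by (rule order_1)
    fix p assume p: "p permutes {..<d}"
    have "p i \<le> d - 1" if "i < d" for i using permutes_in_image[OF p, of i] that by auto
    then show "?N \<le> (\<Sum>i<d. ?e i - p i)" by (intro sum_mono diff_le_mono2) simp
  qed
  have "d * ?e i \<le> Suc d * (?e i - (d - 1))" if "i < d" for i
  proof -
    have "?e i = 0 \<or> ?e i \<ge> 15" using o[OF transpose_le[OF \<open>j \<le> d\<close> that]] by simp
    moreover have "d = 2 \<or> d = 3 \<or> d = 4" using assms by auto
    ultimately show ?thesis by auto
  qed
  then have "(\<Sum>i<d. d * ?e i) \<le> (\<Sum>i<d. Suc d * (?e i - (d - 1)))" by (intro sum_mono) simp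
  then have "d * (\<Sum>i<d. ?e i) \<le> Suc d * ?N" by (simp only: sum_distrib_left)
  then have "d * (\<Sum>i\<le>d. order r (f i)) \<le> Suc d * ?N"
    using sum_transpose[OF \<open>j \<le> d\<close>, of "\<lambda>i. order r (f i)"] assms(5) by simp
  with 1 2 3 show ?thesis by blast
qed

text \<open>The losses are added up before comparing: five rows lose at most 0 + 1 + 2 + 3 + 4 = 10
  together, and 5 * S \<le> 6 * (S - 10) holds from S = 60 on.\<close>

lemma circuit_local_high:
  fixes f :: "nat \<Rightarrow> 'a :: field_char_0 poly"
  assumes "circuit {..5} f" "j \<le> 5" "order r (f j) = 0"
    and o: "(\<Sum>i\<le>5. order r (f i)) \<ge> 60"
  shows "\<exists>g N. lin_indep 5 g \<and> (\<forall>i<5. \<exists>c. g i = (\<Sum>j\<le>5. smult (c j) (f j))) \<and>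
      [:-r, 1:] ^ N dvd wronskian 5 g \<and> 5 * (\<Sum>i\<le>5. order r (f i)) \<le> Suc 5 * N"
proof -
  let ?g = "f \<circ> transpose j 5"
  let ?e = "\<lambda>i. order r (?g i)"
  let ?N = "(\<Sum>i<5. ?e i) - 10"
  have 1: "lin_indep 5 ?g" using assms by (intro circuit_lin_indep)
  have 2: "\<exists>c. ?g i = (\<Sum>j\<le>5. smult (c j) (f j))" if "i < 5" for i
    using in_span[OF transpose_le[OF \<open>j \<le> 5\<close> that]] by simp
  have 3: "[:-r, 1:] ^ ?N dvd wronskian 5 ?g"
  proof (rule power_dvd_wronskian)
    show "[:-r, 1:] ^ ?e i dvd ?g i" for i by (rule order_1)
    fix p assume p: "p permutes {..<5 :: nat}"
    have "(\<Sum>i<5. ?e i) \<le> (\<Sum>i<5. (?e i - p i) + p i)" by (intro sum_mono) simp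
    also have "\<dots> = (\<Sum>i<5. ?e i - p i) + 10"
      using sum_permutes_id[OF p] by (simp add: sum.distrib)
    finally show "?N \<le> (\<Sum>i<5. ?e i - p i)" by simp
  qed
  have "5 * (\<Sum>i\<le>5. order r (f i)) \<le> Suc 5 * ?N"
    using sum_transpose[OF \<open>j \<le> 5\<close>, of "\<lambda>i. order r (f i)"] assms(3) o by simp
  with 1 2 3 show ?thesis by blast
qed

text \<open>A combination of the two vanishing members vanishes to order \<open>t + 1\<close>, so that the
  Wronskian loses \<open>6\<close> instead of \<open>7\<close> from the expected order. This is what makes the
  exponent \<open>18\<close> suffice.\<close>

lemma circuit_local_pair:
  fixes f :: "nat \<Rightarrow> 'a :: field_char_0 poly"
  assumes circ: "circuit {..5} f" and pq: "p \<le> 5" "q \<le> 5" "p \<noteq> q" and t: "t \<ge> 18"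
    and o: "order r (f p) = t" "order r (f q) = t" 
      "\<And>i. i \<le> 5 \<Longrightarrow> i \<noteq> p \<Longrightarrow> i \<noteq> q \<Longrightarrow> order r (f i) = 0"
    and nz: "f p \<noteq> 0" "f q \<noteq> 0"
  shows "\<exists>g N. lin_indep 5 g \<and> (\<forall>i<5. \<exists>c. g i = (\<Sum>j\<le>5. smult (c j) (f j))) \<and>
      [:-r, 1:] ^ N dvd wronskian 5 g \<and> 5 * (\<Sum>i\<le>5. order r (f i)) \<le> Suc 5 * N"
proof -
  let ?x = "[:-r, 1:]"
  \<comment> \<open>The omitted index must differ from \<open>p\<close> and \<open>q\<close>, so
    that both stay available for the combination.\<close>
  obtain j where j: "j \<le> 5" "j \<noteq> p" "j \<noteq> q"
  proof -
    have "card ({..5} - {p, q}) = 4" using pq by (subst card_Diff_subset) auto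
    then have "{..5} - {p, q} \<noteq> {}" by (metis card.empty zero_neq_numeral)
    then show ?thesis using that by auto
  qed
  define g0 where "g0 = f \<circ> transpose j 5"
  define p' q' where "p' = transpose j 5 p" and "q' = transpose j 5 q"
  have p': "p' < 5" "q' < 5" "p' \<noteq> q'" and g0: "g0 p' = f p" "g0 q' = f q"
    using pq j by (auto simp: p'_def q'_def transpose_def g0_def)
  have li0: "lin_indep 5 g0" unfolding g0_def using circ j(1) by (rule circuit_lin_indep)
  obtain P where P: "f p = ?x ^ t * P" "\<not> ?x dvd P"
    using order_decomp[OF nz(1), of r] o by auto
  obtain Q where Q: "f q = ?x ^ t * Q" "\<not> ?x dvd Q"
    using order_decomp[OF nz(2), of r] o by auto
  \<comment> \<open>Chosen to make \<open>Q - smult c P\<close> vanish at \<open>r\<close>.\<close>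
  define c where "c = poly Q r / poly P r"
  have "poly P r \<noteq> 0" using P(2) by (simp add: poly_eq_0_iff_dvd)
  then have "?x dvd Q - smult c P"
    by (simp add: poly_eq_0_iff_dvd[symmetric] c_def)
  then have dvd: "?x ^ Suc t dvd f q - smult c (f p)"
    unfolding P Q power_Suc2 mult_smult_right[symmetric] right_diff_distrib[symmetric]
    by (rule mult_dvd_mono[OF dvd_refl])
  define g where "g = g0(q' := f q - smult c (f p))"
  have 1: "lin_indep 5 g"
    unfolding lin_indep_def
  proof (intro allI impI)
    fix b i assume b: "(\<Sum>i<5. smult (b i) (g i)) = 0" and "i < (5 :: nat)"
    \<comment> \<open>The coefficients of the same combination with respect to
      \<open>g0\<close>.\<close>
    define b' where "b' = b(p' := b p' - b q' * c)"
    have split: "(\<Sum>i<5. h i) = h p' + (h q' + (\<Sum>i\<in>{..<5} - {p', q'}. h i))" for h :: "nat \<Rightarrow> 'a poly"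
    proof -
      have "(\<Sum>i<5. h i) = h p' + (\<Sum>i\<in>{..<5} - {p'}. h i)"
        using p' by (intro sum.remove) auto
      also have "(\<Sum>i\<in>{..<5} - {p'}. h i) = h q' + (\<Sum>i\<in>{..<5} - {p'} - {q'}. h i)"
        using p' by (intro sum.remove) auto
      finally show ?thesis by (simp only: Diff_insert2[of _ p' "{q'}"])
    qed
    have "(\<Sum>i<5. smult (b' i) (g0 i)) = (\<Sum>i<5. smult (b i) (g i))"
      unfolding split using p' g0
      by (simp add: b'_def g_def smult_diff_left smult_diff_right)
    with b li0 have b0: "\<forall>i<5. b' i = 0" unfolding lin_indep_def by metis
    then have "b' q' = 0" "b' p' = 0" using p' by auto
    then have "b q' = 0" "b p' = 0" using p' by (auto simp: b'_def)
    then show "b i = 0" using b0 \<open>i < 5\<close> by (metis b'_def fun_upd_apply)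
  qed
  have 2: "\<exists>c. g i = (\<Sum>j\<le>5. smult (c j) (f j))" if i: "i < 5" for i
  proof (cases "i = q'")
    case True
    obtain cp where cp: "f p = (\<Sum>j\<le>5. smult (cp j) (f j))" using in_span[OF pq(1)] by blast
    obtain cq where cq: "f q = (\<Sum>j\<le>5. smult (cq j) (f j))" using in_span[OF pq(2)] by blast
    have "g i = (\<Sum>j\<le>5. smult (cq j - c * cp j) (f j))"
      unfolding smult_diff_left sum_subtractf smult_smult[symmetric] smult_sum_right[symmetric]
        cp[symmetric] cq[symmetric] using True by (simp add: g_def)
    then show ?thesis by (intro exI[of _ "\<lambda>j. cq j - c * cp j"])
  next
    case False
    then show ?thesis using in_span[OF transpose_le[OF j(1) i]] by (simp add: g_def g0_def)
  qed
  let ?e = "\<lambda>i. if i = p' then t else if i = q' then Suc t else 0"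
  have 3: "?x ^ (2 * t - 6) dvd wronskian 5 g"
  proof (rule power_dvd_wronskian)
    fix i assume "i < (5 :: nat)"
    show "?x ^ ?e i dvd g i"
      using dvd P(1) g0 p' by (simp add: g_def)
  next
    fix s assume s: "s permutes {..<5 :: nat}"
    have "s p' \<le> 4" "s q' \<le> 4"
      using permutes_in_image[OF s, of p'] permutes_in_image[OF s, of q'] p' by auto
    moreover have "s p' \<noteq> s q'" using p'(3) permutes_inj[OF s] by (metis injD)
    ultimately have "2 * t - 6 \<le> (t - s p') + (Suc t - s q')" by linarith
    also have "\<dots> = (\<Sum>i\<in>{p', q'}. ?e i - s i)" using p' by simp
    also have "\<dots> \<le> (\<Sum>i<5. ?e i - s i)" using p' by (intro sum_mono2) auto
    finally show "2 * t - 6 \<le> (\<Sum>i<5. ?e i - s i)" .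
  qed
  have "(\<Sum>i\<le>5. order r (f i)) = (\<Sum>i\<in>{p, q}. order r (f i))"
    using pq o(3) by (intro sum.mono_neutral_right) auto
  then have "(\<Sum>i\<le>5. order r (f i)) = 2 * t" using pq o by simp
  \<comment> \<open>The inequality 10 * t \<le> 12 * t - 36 holds exactly from t = 18 on.\<close>
  then have "5 * (\<Sum>i\<le>5. order r (f i)) \<le> Suc 5 * (2 * t - 6)" using t by simp
  with 1 2 3 show ?thesis by blast
qed

section \<open>Removing common zeros; circuits have at most two elements\<close>

lemma circuit_cancel:
  fixes h :: "'i \<Rightarrow> 'a :: idom poly"
  assumes "g \<noteq> 0"
  shows "circuit J (\<lambda>i. g * h i) \<longleftrightarrow> circuit J h"
proof -
  have "(\<Sum>i\<in>J. smult (c i) (g * h i)) = g * (\<Sum>i\<in>J. smult (c i) (h i))" for c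
    by (simp add: sum_distrib_left)
  then show ?thesis using assms by (simp add: circuit_def)
qed

lemma circuit_cong:
  assumes "\<And>i. i \<in> J \<Longrightarrow> u i = v i"
  shows "circuit J u \<longleftrightarrow> circuit J v"
proof -
  have "(\<Sum>i\<in>J. smult (c i) (u i)) = (\<Sum>i\<in>J. smult (c i) (v i))" for c
    using assms by (intro sum.cong) auto
  then show ?thesis by (simp add: circuit_def)
qed

lemma circuit_reindex:
  assumes "bij_betw h I J" "circuit J u"
  shows "circuit I (u \<circ> h)"
proof -
  have sum: "(\<Sum>i\<in>I. smult (c (h i)) ((u \<circ> h) i)) = (\<Sum>j\<in>J. smult (c j) (u j))" for c
    using sum.reindex_bij_betw[OF assms(1), of "\<lambda>j. smult (c j) (u j)"] by (simp add: o_def)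
  have ex: "(\<exists>i\<in>I. P (h i)) \<longleftrightarrow> (\<exists>j\<in>J. P j)" and all: "(\<forall>i\<in>I. P (h i)) \<longleftrightarrow> (\<forall>j\<in>J. P j)" for P
    using assms(1) unfolding bij_betw_def by auto
  show ?thesis
    unfolding circuit_def
  proof (intro conjI allI impI)
    obtain c where "(\<Sum>j\<in>J. smult (c j) (u j)) = 0" "\<exists>i\<in>J. c i \<noteq> 0"
      using assms(2) unfolding circuit_def by blast
    then show "\<exists>c. (\<Sum>i\<in>I. smult (c i) ((u \<circ> h) i)) = 0 \<and> (\<exists>i\<in>I. c i \<noteq> 0)"
      using ex[of "\<lambda>j. c j \<noteq> 0"] sum[of c] by (intro exI[of _ "c \<circ> h"]) auto
  next
    fix c assume c: "(\<Sum>i\<in>I. smult (c i) ((u \<circ> h) i)) = 0" "\<exists>i\<in>I. c i = 0"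
    define c' where "c' = c \<circ> inv_into I h"
    have c': "c' (h i) = c i" if "i \<in> I" for i
      using assms(1) that by (simp add: c'_def bij_betw_def)
    have "(\<Sum>j\<in>J. smult (c' j) (u j)) = 0"
      unfolding sum[of c', symmetric] using c(1) by (simp add: c' cong: sum.cong)
    moreover have "\<exists>j\<in>J. c' j = 0"
      using c(2) c' unfolding ex[of "\<lambda>j. c' j = 0", symmetric] by auto
    ultimately have "\<forall>j\<in>J. c' j = 0" using assms(2) unfolding circuit_def by blast
    then show "\<forall>i\<in>I. c i = 0" unfolding all[of "\<lambda>j. c' j = 0", symmetric] by (simp add: c')
  qed
qed

text \<open>For a common divisor \<open>g\<close> of largest degree, a zero \<open>r\<close> shared
  by all \<open>h i\<close> would make \<open>g * [:-r, 1:]\<close> a larger one. Afterwards every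
  point has a nonvanishing term that can be left out of the Wronskian.\<close>

lemma common_factor:
  fixes u :: "nat \<Rightarrow> 'a :: field poly"
  assumes nz: "\<And>i. i \<le> d \<Longrightarrow> u i \<noteq> 0"
  obtains g h where "g \<noteq> 0" "\<And>i. i \<le> d \<Longrightarrow> u i = g * h i"
    "\<And>r. \<exists>i\<le>d. order r (h i) = 0"
proof -
  let ?P = "\<lambda>m. \<exists>g. degree g = m \<and> (\<forall>i\<le>d. g dvd u i)"
  define m where "m = Greatest ?P"
  have P0: "?P 0" by (intro exI[of _ 1]) simp
  have bnd: "m \<le> degree (u 0)" if "?P m" for m
    using that nz by (auto intro: dvd_imp_degree_le)
  have m: "?P m" unfolding m_def by (rule GreatestI_nat[of ?P, OF P0 bnd])
  have m_max: "m' \<le> m" if "?P m'" for m'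
    unfolding m_def by (rule Greatest_le_nat[of ?P, OF that bnd])
  from m obtain g where g: "degree g = m" "\<And>i. i \<le> d \<Longrightarrow> g dvd u i" by blast
  then have "\<forall>i. \<exists>h. i \<le> d \<longrightarrow> u i = g * h" unfolding dvd_def by blast
  then obtain h where h: "\<And>i. i \<le> d \<Longrightarrow> u i = g * h i" by metis
  have "g \<noteq> 0" using h[of 0] nz[of 0] by auto
  moreover have "\<exists>i\<le>d. order r (h i) = 0" for r
  proof (rule ccontr)
    assume *: "\<not> (\<exists>i\<le>d. order r (h i) = 0)"
    have "g * [:-r, 1:] dvd u i" if "i \<le> d" for i
      unfolding h[OF that] using * that
      by (intro mult_dvd_mono) (auto simp: poly_eq_0_iff_dvd[symmetric] order_root simp del: One_nat_def)
    moreover have "degree (g * [:-r, 1:]) = Suc m"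
      using \<open>g \<noteq> 0\<close> g(1) by (subst degree_mult_eq) auto
    ultimately show False using m_max[of "Suc m"] by auto
  qed
  ultimately show ?thesis using that h by blast
qed

text \<open>Below six terms every nonzero order exceeds 15. With six, the orders of \<open>h\<close>
  at \<open>r\<close>, in units of \<open>k\<close>, have the same total on the indices 0, 1, 2 as
  on 3, 4, 5. Total 0 is trivial, total 1 is a pair vanishing to order \<open>k\<close>, and from
  total 2 on the sum of all orders is at least 4 * 18 > 60.\<close>

lemma no_long_circuit_aux:
  fixes u :: "nat \<Rightarrow> 'a :: {alg_closed_field, field_char_0} poly"
  assumes k: "k \<ge> 18" and d: "2 \<le> d" "d \<le> 5" and nz: "\<And>i. i \<le> d \<Longrightarrow> u i \<noteq> 0"
    and dvd: "\<And>r i. i \<le> d \<Longrightarrow> k dvd order r (u i)"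
    and bal: "\<And>r. d = 5 \<Longrightarrow> order r (u 0) + order r (u 1) + order r (u 2) =
      order r (u 3) + order r (u 4) + order r (u 5)"
    and circ: "circuit {..d} u"
  shows False
proof -
  obtain g h where g: "g \<noteq> 0" and h: "\<And>i. i \<le> d \<Longrightarrow> u i = g * h i"
    and cop: "\<And>r. \<exists>i\<le>d. order r (h i) = 0"
    by (rule common_factor[OF nz]) blast+
  have hnz: "h i \<noteq> 0" if "i \<le> d" for i using nz[OF that] h[OF that] by auto
  have ord: "order r (u i) = order r g + order r (h i)" if "i \<le> d" for r i
    using that g hnz by (simp add: h order_mult)
  \<comment> \<open>Some \<open>h j\<close> does not vanish at \<open>r\<close>, so
    \<open>order r g\<close> equals the order of \<open>u j\<close>, a multiple of \<open>k\<close>;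
    dividing by \<open>g\<close> preserves the divisibility.\<close>
  have hdvd: "k dvd order r (h i)" if "i \<le> d" for r i
  proof -
    obtain j where "j \<le> d" "order r (h j) = 0" using cop by blast
    then have "k dvd order r g" using dvd[of j r] ord[of j r] by simp
    then show ?thesis using dvd[OF that, of r] ord[OF that] by (metis dvd_add_right_iff)
  qed
  have "circuit {..d} (\<lambda>i. g * h i)"
    using circ circuit_cong[of "{..d}" u "\<lambda>i. g * h i"] h by simp
  then have circ': "circuit {..d} h" using circuit_cancel[OF g, of "{..d}" h] by simp
  show False
  proof (rule circuit_wronskian_order[OF d(1) hnz circ'])
    fix r
    obtain j where j: "j \<le> d" "order r (h j) = 0" using cop by blast
    show "\<exists>g N. lin_indep d g \<and> (\<forall>i<d. \<exists>c. g i = (\<Sum>j\<le>d. smult (c j) (h j))) \<and>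
      [:-r, 1:] ^ N dvd wronskian d g \<and> d * (\<Sum>i\<le>d. order r (h i)) \<le> Suc d * N"
    proof (cases "d = 5")
      case False
      have "order r (h i) = 0 \<or> order r (h i) \<ge> 15" if "i \<le> d" for i
        using hdvd[OF that, of r] k dvd_imp_le[of k "order r (h i)"] by linarith
      then show ?thesis using d False circ' j by (intro circuit_local_low) auto
    next
      case d5: True
      have "\<forall>i. \<exists>m. i \<le> 5 \<longrightarrow> order r (h i) = k * m"
        using hdvd d5 unfolding dvd_def by blast
      then obtain m where m: "\<And>i. i \<le> 5 \<Longrightarrow> order r (h i) = k * m i" by metis
      have "m 0 + m 1 + m 2 = m 3 + m 4 + m 5"
      proof -
        \<comment> \<open>The order of \<open>g\<close> enters three times on either side and
          cancels.\<close>
        have "k * (m 0 + m 1 + m 2) = k * (m 3 + m 4 + m 5)"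
          using bal[OF d5, of r] m by (simp add: d5 ord distrib_left)
        then show ?thesis using k by simp
      qed
      moreover have S: "(\<Sum>i\<le>5. order r (h i)) = k * (m 0 + m 1 + m 2) + k * (m 3 + m 4 + m 5)"
      proof -
        have "{..5 :: nat} = {0, 1, 2, 3, 4, 5}" by auto
        then show ?thesis by (simp add: m distrib_left)
      qed
      ultimately consider "m 0 + m 1 + m 2 = 0" "m 3 + m 4 + m 5 = 0"
        | "m 0 + m 1 + m 2 = 1" "m 3 + m 4 + m 5 = 1"
        | "m 0 + m 1 + m 2 \<ge> 2" "m 3 + m 4 + m 5 \<ge> 2" by linarith
      then show ?thesis
      proof cases
        case 1
        have "lin_indep 5 h" using circuit_lin_indep[of 5 h 5] circ' d5 by (simp add: o_def)
        then show ?thesis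
          using 1 S d5 in_span[of _ 5 h] by (intro exI[of _ h] exI[of _ 0]) auto
      next
        case 2
        obtain p where p: "p \<in> {0, 1, 2}" "m p = 1" "\<forall>i\<in>{0, 1, 2}. i \<noteq> p \<longrightarrow> m i = 0"
        proof -
          have "m 0 = 1 \<and> m 1 = 0 \<and> m 2 = 0 \<or> m 0 = 0 \<and> m 1 = 1 \<and> m 2 = 0 \<or>
            m 0 = 0 \<and> m 1 = 0 \<and> m 2 = 1" using 2(1) by linarith
          then show ?thesis
            using that[of 0] that[of 1] that[of 2] by auto
        qed
        obtain q where q: "q \<in> {3, 4, 5}" "m q = 1" "\<forall>i\<in>{3, 4, 5}. i \<noteq> q \<longrightarrow> m i = 0"
        proof -
          have "m 3 = 1 \<and> m 4 = 0 \<and> m 5 = 0 \<or> m 3 = 0 \<and> m 4 = 1 \<and> m 5 = 0 \<or>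
            m 3 = 0 \<and> m 4 = 0 \<and> m 5 = 1" using 2(2) by linarith
          then show ?thesis
            using that[of 3] that[of 4] that[of 5] by auto
        qed
        have pq: "p \<le> 5" "q \<le> 5" "p \<noteq> q" using p(1) q(1) by auto
        have rest: "m i = 0" if "i \<le> 5" "i \<noteq> p" "i \<noteq> q" for i
        proof -
          have "i \<in> {0, 1, 2} \<or> i \<in> {3, 4, 5}" using that(1) by auto
          then show ?thesis
            using p(3)[rule_format, OF _ that(2)] q(3)[rule_format, OF _ that(3)] by metis
        qed
        show ?thesis
          unfolding d5
        proof (rule circuit_local_pair)
          show "circuit {..5} h" using circ' d5 by simp
          show "order r (h p) = k" "order r (h q) = k" using m pq p(2) q(2) by simp_all
          show "h p \<noteq> 0" "h q \<noteq> 0" using hnz d5 pq by simp_all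
          show "order r (h i) = 0" if "i \<le> 5" "i \<noteq> p" "i \<noteq> q" for i
            using rest[OF that] m[OF that(1)] by simp
        qed (fact pq k)+
      next
        case 3
        have "k * (m 0 + m 1 + m 2) \<ge> 18 * 2" "k * (m 3 + m 4 + m 5) \<ge> 18 * 2"
          by (rule mult_le_mono[OF k 3(1)], rule mult_le_mono[OF k 3(2)])
        then have "(\<Sum>i\<le>5. order r (h i)) \<ge> 60" unfolding S by linarith
        then show ?thesis
          using circuit_local_high[of h j r] circ' j d5 by simp
      qed
    qed
  qed
qed

text \<open>Reindexing by \<open>h\<close> mixes up the two sides, which is harmless below six
  terms, where no balance is asked for. The full index set keeps its numbering.\<close>

lemma no_long_circuit:
  fixes u :: "nat \<Rightarrow> 'a :: {alg_closed_field, field_char_0} poly"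
  assumes k: "k \<ge> 18" and J: "J \<subseteq> {..5}" and nz: "\<And>i. i \<in> J \<Longrightarrow> u i \<noteq> 0"
    and dvd: "\<And>r i. i \<in> J \<Longrightarrow> k dvd order r (u i)"
    and bal: "\<And>r. J = {..5} \<Longrightarrow> order r (u 0) + order r (u 1) + order r (u 2) =
      order r (u 3) + order r (u 4) + order r (u 5)"
    and circ: "circuit J u"
  shows "card J \<le> 2"
proof (rule ccontr)
  assume "\<not> card J \<le> 2"
  then obtain d where d: "card J = Suc d" "2 \<le> d" by (cases "card J") auto
  have fin: "finite J" using J finite_subset by blast
  have "card J \<le> 6" using card_mono[OF _ J] by simp
  then have "d \<le> 5" using d by simp
  show False
  proof (cases "d = 5")
    case True
    then have "J = {..5}" using card_subset_eq[OF _ J] d by simp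
    then show False using no_long_circuit_aux[OF k, of 5 u] nz dvd bal circ by simp
  next
    case False
    obtain h where h: "bij_betw h {..<card J} J"
      using ex_bij_betw_nat_finite[OF fin] by (auto simp: lessThan_atLeast0)
    then have h: "bij_betw h {..d} J" by (simp add: d lessThan_Suc_atMost)
    then have "h i \<in> J" if "i \<le> d" for i using that by (auto dest: bij_betwE)
    then show False
      using no_long_circuit_aux[OF k d(2) \<open>d \<le> 5\<close>, of "u \<circ> h"] nz dvd False
        circuit_reindex[OF h circ] by simp
  qed
qed

section \<open>Constant multiples\<close>

text \<open>For nonzero polynomials over an algebraically closed field this means differing by a
  constant factor. Stated through orders, it turns relations between products into linear equations
  at each point.\<close>

definition proportional :: "'a :: idom poly \<Rightarrow> 'a poly \<Rightarrow> bool" where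
  "proportional p q \<longleftrightarrow> (\<forall>r. order r p = order r q)"

lemma proportional_sym: "proportional p q \<Longrightarrow> proportional q p"
  and proportional_trans: "proportional p q \<Longrightarrow> proportional q s \<Longrightarrow> proportional p s"
  and proportional_refl [simp]: "proportional p p"
  by (auto simp: proportional_def)

lemma proportional_smult: "c \<noteq> 0 \<Longrightarrow> proportional (smult c p) p"
  by (simp add: proportional_def order_smult)

lemma proportionalE:
  fixes p q :: "'a :: alg_closed_field poly"
  assumes "proportional p q" "p \<noteq> 0" "q \<noteq> 0"
  obtains c where "c \<noteq> 0" "p = smult c q"
proof -
  have "p dvd q" "q dvd p" using assms by (auto simp: proportional_def intro!: dvd_if_order_le)
  then obtain s where s: "p = q * s" by (auto elim: dvdE)
  then have "s \<noteq> 0" using assms by auto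
  have "degree p = degree q"
    using \<open>p dvd q\<close> \<open>q dvd p\<close> assms by (simp add: dvd_imp_degree_le antisym)
  then have "degree s = 0" using s \<open>s \<noteq> 0\<close> assms by (simp add: degree_mult_eq)
  then obtain c where "s = [:c:]" by (metis degree_eq_zeroE)
  with s \<open>s \<noteq> 0\<close> show ?thesis using that[of c] by auto
qed

lemma proportional_diff:
  fixes p q :: "'a :: alg_closed_field poly"
  assumes "proportional p q" "p \<noteq> 0" "q \<noteq> 0" "p \<noteq> q"
  shows "proportional (p - q) q"
proof -
  obtain c where "c \<noteq> 0" and c: "p = smult c q" using assms by (auto elim: proportionalE)
  then have "p - q = smult (c - 1) q" by (simp add: smult_diff_left)
  moreover have "c - 1 \<noteq> 0" using c assms(4) by auto
  ultimately show ?thesis by (simp add: proportional_smult)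
qed

text \<open>A nontrivial relation that misses an index survives dropping it, so the shrinking stops
  only at a circuit.\<close>

lemma dependent_contains_circuit:
  assumes "finite J" "(\<Sum>i\<in>J. smult (c i) (u i)) = 0" "\<exists>i\<in>J. c i \<noteq> 0"
  shows "\<exists>K\<subseteq>J. circuit K u"
  using assms
proof (induction "card J" arbitrary: J c rule: less_induct)
  case less
  show ?case
  proof (cases "circuit J u")
    case False
    then obtain b where b: "(\<Sum>i\<in>J. smult (b i) (u i)) = 0" "\<exists>i\<in>J. b i = 0" "\<exists>i\<in>J. b i \<noteq> 0"
      using less.prems unfolding circuit_def by metis
    then obtain i where i: "i \<in> J" "b i = 0" by blast
    have "card (J - {i}) < card J" using less.prems(1) i(1) by (rule card_Diff1_less)
    moreover have "(\<Sum>i\<in>J - {i}. smult (b i) (u i)) = 0"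
      using b(1) i sum.remove[OF less.prems(1) i(1), of "\<lambda>i. smult (b i) (u i)"] by simp
    moreover have "\<exists>i\<in>J - {i}. b i \<noteq> 0" using b(3) i by auto
    ultimately obtain K where "K \<subseteq> J - {i}" "circuit K u"
      using less.hyps[of "J - {i}" b] less.prems(1) by blast
    then show ?thesis by blast
  qed blast
qed

text \<open>Collecting each class on a representative gives a relation between pairwise
  nonproportional polynomials. A surviving coefficient would produce a circuit among them with at
  most two elements, but one element would be zero and two would be proportional.\<close>

lemma class_sum_zero:
  fixes u :: "nat \<Rightarrow> 'a :: alg_closed_field poly"
  assumes fin: "finite J" and nz: "\<And>i. i \<in> J \<Longrightarrow> u i \<noteq> 0"
    and short: "\<And>K. K \<subseteq> J \<Longrightarrow> circuit K u \<Longrightarrow> card K \<le> 2"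
    and sum0: "(\<Sum>i\<in>J. smult (c i) (u i)) = 0" and i: "i \<in> J"
  shows "(\<Sum>j\<in>J. if proportional (u j) (u i) then smult (c j) (u j) else 0) = 0"
proof -
  define \<rho> where "\<rho> j = (LEAST l. l \<in> J \<and> proportional (u l) (u j))" for j
  have \<rho>: "\<rho> j \<in> J" "proportional (u (\<rho> j)) (u j)" if "j \<in> J" for j
    using LeastI[of "\<lambda>l. l \<in> J \<and> proportional (u l) (u j)" j] that by (auto simp: \<rho>_def)
  have \<rho>_eq: "\<rho> j = \<rho> l" if "proportional (u j) (u l)" for j l
  proof -
    have "proportional (u m) (u j) \<longleftrightarrow> proportional (u m) (u l)" for m
      using that proportional_trans proportional_sym by blast
    then show ?thesis by (simp add: \<rho>_def)
  qed
  have "\<exists>a. u j = smult a (u (\<rho> j))" if "j \<in> J" for j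
    using proportionalE[OF proportional_sym[OF \<rho>(2)[OF that]] nz[OF that] nz[OF \<rho>(1)[OF that]]] by metis
  then have "\<forall>j. \<exists>a. j \<in> J \<longrightarrow> u j = smult a (u (\<rho> j))" by blast
  from choice[OF this] obtain a where a: "\<And>j. j \<in> J \<Longrightarrow> u j = smult (a j) (u (\<rho> j))" by blast
  define C where "C l = (\<Sum>j | j \<in> J \<and> \<rho> j = l. c j * a j)" for l
  have C: "(\<Sum>j | j \<in> J \<and> \<rho> j = l. smult (c j) (u j)) = smult (C l) (u l)" for l
  proof -
    have "(\<Sum>j | j \<in> J \<and> \<rho> j = l. smult (c j) (u j)) = (\<Sum>j | j \<in> J \<and> \<rho> j = l. smult (c j * a j) (u l))"
    proof (rule sum.cong[OF refl])
      fix j assume "j \<in> {j. j \<in> J \<and> \<rho> j = l}"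
      then have "u j = smult (a j) (u l)" using a[of j] by simp
      then show "smult (c j) (u j) = smult (c j * a j) (u l)" by (metis smult_smult)
    qed
    then show ?thesis by (simp add: C_def smult_sum)
  qed
  have "(\<Sum>l\<in>\<rho> ` J. smult (C l) (u l)) = 0"
    using sum.group[OF fin finite_imageI[OF fin] subset_refl, of "\<lambda>j. smult (c j) (u j)" \<rho>] sum0
    by (simp add: C)
  have "C (\<rho> i) = 0"
  proof (rule ccontr)
    assume "C (\<rho> i) \<noteq> 0"
    then have "\<exists>l\<in>\<rho> ` J. C l \<noteq> 0" using i by blast
    with \<open>(\<Sum>l\<in>\<rho> ` J. smult (C l) (u l)) = 0\<close> obtain K where K: "K \<subseteq> \<rho> ` J" "circuit K u"
      using dependent_contains_circuit[OF finite_imageI[OF fin]] by blast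
    have KJ: "K \<subseteq> J" using K(1) \<rho>(1) by blast
    have fix_K: "\<rho> l = l" if "l \<in> K" for l
    proof -
      from that K(1) obtain j where j: "j \<in> J" "l = \<rho> j" by blast
      then show ?thesis using \<rho>_eq[OF \<rho>(2)[OF j(1)]] by simp
    qed
    obtain b where b: "(\<Sum>l\<in>K. smult (b l) (u l)) = 0" and "\<exists>l\<in>K. b l \<noteq> 0"
      using K(2) unfolding circuit_def by blast
    then have b0: "b l \<noteq> 0" if "l \<in> K" for l
      using that K(2) unfolding circuit_def by blast
    have "card K \<le> 2" using short KJ K(2) by blast
    moreover have "finite K" using KJ fin finite_subset by blast
    moreover have "K \<noteq> {}" using \<open>\<exists>l\<in>K. b l \<noteq> 0\<close> by blast
    ultimately have "card K = 1 \<or> card K = 2" by (metis One_nat_def card_0_eq le_Suc_eq le_zero_eq numeral_2_eq_2)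
    then show False
    proof
      assume "card K = 1"
      then obtain l where "K = {l}" by (auto simp: card_1_singleton_iff)
      then show False using b b0[of l] nz[of l] KJ by simp
    next
      assume "card K = 2"
      then obtain l m where lm: "K = {l, m}" "l \<noteq> m" by (auto simp: card_2_iff)
      then have "smult (b l) (u l) = smult (- b m) (u m)"
        using b by (simp add: eq_neg_iff_add_eq_0)
      moreover have "proportional (smult (b l) (u l)) (u l)" "proportional (smult (- b m) (u m)) (u m)"
        using b0 lm by (auto intro!: proportional_smult simp del: smult_minus_left)
      ultimately have "proportional (u l) (u m)"
        by (metis proportional_sym proportional_trans)
      then show False using \<rho>_eq[of l m] fix_K[of l] fix_K[of m] lm by simp
    qed
  qed
  then have "(\<Sum>j | j \<in> J \<and> \<rho> j = \<rho> i. smult (c j) (u j)) = 0" by (simp add: C)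
  moreover have "\<rho> j = \<rho> i \<longleftrightarrow> proportional (u j) (u i)" if "j \<in> J" for j
    using \<rho>_eq \<rho>(2)[OF that] \<rho>(2)[OF i] proportional_sym proportional_trans by metis
  then have "{j. j \<in> J \<and> \<rho> j = \<rho> i} = {j \<in> J. proportional (u j) (u i)}" by auto
  ultimately show ?thesis using sum.inter_filter[OF fin] by metis
qed

text \<open>The class of \<open>x\<close> has sum zero. If it missed \<open>y\<close> or
  \<open>z\<close>, subtracting from \<open>x + y + z = 0\<close> would force one of the three terms
  to vanish.\<close>

lemma three_terms_proportional:
  fixes x y z :: "'a :: {alg_closed_field, field_char_0} poly"
  assumes k: "k \<ge> 18" and nz: "x \<noteq> 0" "y \<noteq> 0" "z \<noteq> 0" and sum0: "x + y + z = 0"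
    and dvd: "\<And>r. k dvd order r x" "\<And>r. k dvd order r y" "\<And>r. k dvd order r z"
  shows "proportional y x \<and> proportional z x"
proof -
  define u where "u i = [x, y, z] ! i" for i
  \<comment> \<open>Three indices never fill \<open>{..5}\<close>, so the balance condition is
    vacuous.\<close>
  have I: "{0, 1, 2 :: nat} \<subseteq> {..5}" "{0, 1, 2 :: nat} \<noteq> {..5}" by (auto simp: set_eq_iff)
  have "(\<Sum>j\<in>{0, 1, 2}. if proportional (u j) (u 0) then smult 1 (u j) else 0) = 0"
  proof (rule class_sum_zero)
    fix K assume K: "K \<subseteq> {0, 1, 2 :: nat}" "circuit K u"
    show "card K \<le> 2"
    proof (rule no_long_circuit[OF k])
      show "K \<subseteq> {..5}" "circuit K u" using K I by auto
      show "u i \<noteq> 0" if "i \<in> K" for i using that K(1) nz by (auto simp: u_def)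
      show "k dvd order r (u i)" if "i \<in> K" for r i using that K(1) dvd by (auto simp: u_def)
    qed (use K I in blast)
  qed (use nz sum0 in \<open>auto simp: u_def add.assoc\<close>)
  then have "x + (if proportional y x then y else 0) + (if proportional z x then z else 0) = 0"
    by (simp add: u_def add.assoc cong: if_cong)
  then show ?thesis using nz sum0 by (auto split: if_splits simp: add_eq_0_iff add.assoc)
qed

text \<open>The arguments are class labels and \<open>v\<close> is the order at one point. Two
  labels that each match a pair on the other side coincide, as two pairs out of three overlap; so
  each side has a repeated label, say a, a, c and x, x, z with c and z among a, x. In all four cases
  the balance 2 * v a + v c = 2 * v x + v z gives v a = v x.\<close>

lemma six_classes:
  fixes v :: "'b \<Rightarrow> nat"
  assumes "e1 = e2 \<or> e1 = e3 \<or> e1 = o1 \<and> e1 = o2 \<or> e1 = o1 \<and> e1 = o3 \<or> e1 = o2 \<and> e1 = o3"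
    and "e2 = e1 \<or> e2 = e3 \<or> e2 = o1 \<and> e2 = o2 \<or> e2 = o1 \<and> e2 = o3 \<or> e2 = o2 \<and> e2 = o3"
    and "e3 = e1 \<or> e3 = e2 \<or> e3 = o1 \<and> e3 = o2 \<or> e3 = o1 \<and> e3 = o3 \<or> e3 = o2 \<and> e3 = o3"
    and "o1 = o2 \<or> o1 = o3 \<or> o1 = e1 \<and> o1 = e2 \<or> o1 = e1 \<and> o1 = e3 \<or> o1 = e2 \<and> o1 = e3"
    and "o2 = o1 \<or> o2 = o3 \<or> o2 = e1 \<and> o2 = e2 \<or> o2 = e1 \<and> o2 = e3 \<or> o2 = e2 \<and> o2 = e3"
    and "o3 = o1 \<or> o3 = o2 \<or> o3 = e1 \<and> o3 = e2 \<or> o3 = e1 \<and> o3 = e3 \<or> o3 = e2 \<and> o3 = e3"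
    and "v e1 + v e2 + v e3 = v o1 + v o2 + v o3"
  shows "v e2 = v e1 \<and> v e3 = v e1 \<and> v o1 = v e1 \<and> v o2 = v e1 \<and> v o3 = v e1"
proof -
  have e: "e1 = e2 \<or> e1 = e3 \<or> e2 = e3" using assms(1,2) by metis
  have o: "o1 = o2 \<or> o1 = o3 \<or> o2 = o3" using assms(4,5) by metis
  have two: "v a = v x \<and> v c = v x \<and> v z = v x"
    if "c = a \<or> c = x" "z = a \<or> z = x" "v a + v a + v c = v x + v x + v z" for a c x z
    using that by auto
  show ?thesis
    using e
  proof (elim disjE)
    assume e: "e1 = e2"
    show ?thesis using o
    proof (elim disjE)
      assume o: "o1 = o2"
      show ?thesis using two[of e3 e1 o1 o3] assms(3,6,7) unfolding e o by fastforce
    next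
      assume o: "o1 = o3"
      show ?thesis using two[of e3 e1 o1 o2] assms(3,5,7) unfolding e o by fastforce
    next
      assume o: "o2 = o3"
      show ?thesis using two[of e3 e1 o2 o1] assms(3,4,7) unfolding e o by fastforce
    qed
  next
    assume e: "e1 = e3"
    show ?thesis using o
    proof (elim disjE)
      assume o: "o1 = o2"
      show ?thesis using two[of e2 e1 o1 o3] assms(2,6,7) unfolding e o by fastforce
    next
      assume o: "o1 = o3"
      show ?thesis using two[of e2 e1 o1 o2] assms(2,5,7) unfolding e o by fastforce
    next
      assume o: "o2 = o3"
      show ?thesis using two[of e2 e1 o2 o1] assms(2,4,7) unfolding e o by fastforce
    qed
  next
    assume e: "e2 = e3"
    show ?thesis using o
    proof (elim disjE)
      assume o: "o1 = o2"
      show ?thesis using two[of e1 e2 o1 o3] assms(1,6,7) unfolding e o by fastforce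
    next
      assume o: "o1 = o3"
      show ?thesis using two[of e1 e2 o1 o2] assms(1,5,7) unfolding e o by fastforce
    next
      assume o: "o2 = o3"
      show ?thesis using two[of e1 e2 o2 o1] assms(1,4,7) unfolding e o by fastforce
    qed
  qed
qed

text \<open>If \<open>x\<close> shared its class with nothing on its own side and at most one term
  opposite, it would be zero or equal to that term.\<close>

lemma not_lonely:
  fixes x :: "'b :: ab_group_add"
  assumes "x + (if A then y else 0) + (if B then z else 0) =
      (if P then s else 0) + (if Q then t else 0) + (if R then u else 0)"
    and "x \<noteq> 0" "x \<noteq> s" "x \<noteq> t" "x \<noteq> u"
  shows "A \<or> B \<or> P \<and> Q \<or> P \<and> R \<or> Q \<and> R"
proof (rule ccontr)
  assume *: "\<not> ?thesis"
  then have "\<not> A" "\<not> B" by simp_all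
  moreover have "P \<and> \<not> Q \<and> \<not> R \<or> \<not> P \<and> Q \<and> \<not> R \<or> \<not> P \<and> \<not> Q \<and> R \<or> \<not> P \<and> \<not> Q \<and> \<not> R"
    using * by blast
  ultimately show False using assms by auto
qed

lemma six_terms_proportional:
  fixes e1 e2 e3 o1 o2 o3 :: "'a :: {alg_closed_field, field_char_0} poly"
  assumes k: "k \<ge> 18" 
    and nz: "e1 \<noteq> 0" "e2 \<noteq> 0" "e3 \<noteq> 0" "o1 \<noteq> 0" "o2 \<noteq> 0" "o3 \<noteq> 0" 
    and sum: "e1 + e2 + e3 = o1 + o2 + o3" and prod: "e1 * e2 * e3 = o1 * o2 * o3"
    and dvd: "\<And>r p. p \<in> {e1, e2, e3, o1, o2, o3} \<Longrightarrow> k dvd order r p"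
    and ne: "\<And>p q. p \<in> {e1, e2, e3} \<Longrightarrow> q \<in> {o1, o2, o3} \<Longrightarrow> p \<noteq> q"
    and p: "p \<in> {e2, e3, o1, o2, o3}"
  shows "proportional p e1"
proof -
  \<comment> \<open>The order function serves as class label: \<open>proportional\<close> becomes
    equality of labels, and evaluation at \<open>r\<close> gives the orders that balance.\<close>
  define w where "w = (\<lambda>p r. order r (p :: 'a poly))"
  have prop_iff: "proportional p q \<longleftrightarrow> w p = w q" for p q
    by (auto simp: proportional_def w_def fun_eq_iff)
  define u where "u i = [e1, e2, e3, o1, o2, o3] ! i" for i
  have u: "u 0 = e1" "u 1 = e2" "u 2 = e3" "u 3 = o1" "u 4 = o2" "u 5 = o3" by (simp_all add: u_def)
  define c :: "nat \<Rightarrow> 'a" where "c i = (if i \<le> 2 then 1 else -1)" for i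
  have c: "c 0 = 1" "c 1 = 1" "c 2 = 1" "c 3 = -1" "c 4 = -1" "c 5 = -1" by (simp_all add: c_def)
  have I: "{..5 :: nat} = {0, 1, 2, 3, 4, 5}" by auto
  have sum_I: "(\<Sum>i\<le>5. smult (c i) (h i)) = h 0 + h 1 + h 2 - (h 3 + h 4 + h 5)" for h
    unfolding I by (simp add: c del: One_nat_def)
  have u_in: "u i \<in> {e1, e2, e3, o1, o2, o3}" if "i \<le> 5" for i
  proof -
    have "i \<in> {0, 1, 2, 3, 4, 5}" using that by auto
    then show ?thesis using u by (elim insertE emptyE) simp_all
  qed
  have bal: "order r e1 + order r e2 + order r e3 = order r o1 + order r o2 + order r o3" for r
  proof -
    have "order r (e1 * e2 * e3) = order r (o1 * o2 * o3)" by (simp only: prod)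
    then show ?thesis using nz by (simp add: order_mult)
  qed
  have u_nz: "u i \<noteq> 0" if "i \<le> 5" for i using u_in[OF that] nz by auto
  have "(\<Sum>j\<in>{..5}. if proportional (u j) (u i) then smult (c j) (u j) else 0) = 0" if "i \<le> 5" for i
  proof (rule class_sum_zero)
    fix K assume K: "K \<subseteq> {..5 :: nat}" "circuit K u"
    show "card K \<le> 2"
    proof (rule no_long_circuit[OF k K(1) _ _ _ K(2)])
      show "u i \<noteq> 0" if "i \<in> K" for i using that K(1) u_nz by auto
      show "k dvd order r (u i)" if "i \<in> K" for r i
        by (rule dvd, rule u_in) (use that K(1) in auto)
    qed (use bal u in simp)
  next
    show "(\<Sum>i\<le>5. smult (c i) (u i)) = 0"
      using sum unfolding sum_I u by simp
    show "u i \<noteq> 0" if "i \<in> {..5}" for i using that u_nz by simp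
  qed (use that in simp_all)
  then have "(\<Sum>j\<le>5. smult (c j) (if w (u j) = w (u i) then u j else 0)) = 0" if "i \<le> 5" for i
    using that by (simp only: prop_iff if_distrib smult_0_right)
  then have cls: "(if w e1 = w (u i) then e1 else 0) + (if w e2 = w (u i) then e2 else 0) +
      (if w e3 = w (u i) then e3 else 0) = (if w o1 = w (u i) then o1 else 0) +
      (if w o2 = w (u i) then o2 else 0) + (if w o3 = w (u i) then o3 else 0)" if "i \<le> 5" for i
    using that unfolding sum_I u by simp
  have le: "0 \<le> (5 :: nat)" "1 \<le> (5 :: nat)" "2 \<le> (5 :: nat)" "3 \<le> (5 :: nat)" "4 \<le> (5 :: nat)" "5 \<le> (5 :: nat)"
    by simp_all
  have ne': "p \<noteq> q" "q \<noteq> p" if "p \<in> {e1, e2, e3}" "q \<in> {o1, o2, o3}" for p q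
    using ne[OF that] by auto
  have "w e2 r = w e1 r \<and> w e3 r = w e1 r \<and> w o1 r = w e1 r \<and> w o2 r = w e1 r \<and> w o3 r = w e1 r" for r
  proof (rule six_classes[where v = "\<lambda>f. f r"])
    show "w e1 r + w e2 r + w e3 r = w o1 r + w o2 r + w o3 r" using bal by (simp add: w_def)
    have "e1 + (if w e2 = w e1 then e2 else 0) + (if w e3 = w e1 then e3 else 0) =
        (if w o1 = w e1 then o1 else 0) + (if w o2 = w e1 then o2 else 0) + (if w o3 = w e1 then o3 else 0)"
      using cls[OF le(1), unfolded u] by (simp only: refl if_True add_ac)
    then have "w e2 = w e1 \<or> w e3 = w e1 \<or> w o1 = w e1 \<and> w o2 = w e1 \<or> w o1 = w e1 \<and> w o3 = w e1 \<or>
        w o2 = w e1 \<and> w o3 = w e1"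
      by (rule not_lonely) (fact nz | rule ne'(1); simp)+
    then show "w e1 = w e2 \<or> w e1 = w e3 \<or> w e1 = w o1 \<and> w e1 = w o2 \<or> w e1 = w o1 \<and> w e1 = w o3 \<or>
        w e1 = w o2 \<and> w e1 = w o3"
      by metis
    have "e2 + (if w e1 = w e2 then e1 else 0) + (if w e3 = w e2 then e3 else 0) =
        (if w o1 = w e2 then o1 else 0) + (if w o2 = w e2 then o2 else 0) + (if w o3 = w e2 then o3 else 0)"
      using cls[OF le(2), unfolded u] by (simp only: refl if_True add_ac)
    then have "w e1 = w e2 \<or> w e3 = w e2 \<or> w o1 = w e2 \<and> w o2 = w e2 \<or> w o1 = w e2 \<and> w o3 = w e2 \<or>
        w o2 = w e2 \<and> w o3 = w e2"
      by (rule not_lonely) (fact nz | rule ne'(1); simp)+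
    then show "w e2 = w e1 \<or> w e2 = w e3 \<or> w e2 = w o1 \<and> w e2 = w o2 \<or> w e2 = w o1 \<and> w e2 = w o3 \<or>
        w e2 = w o2 \<and> w e2 = w o3"
      by metis
    have "e3 + (if w e1 = w e3 then e1 else 0) + (if w e2 = w e3 then e2 else 0) =
        (if w o1 = w e3 then o1 else 0) + (if w o2 = w e3 then o2 else 0) + (if w o3 = w e3 then o3 else 0)"
      using cls[OF le(3), unfolded u] by (simp only: refl if_True add_ac)
    then have "w e1 = w e3 \<or> w e2 = w e3 \<or> w o1 = w e3 \<and> w o2 = w e3 \<or> w o1 = w e3 \<and> w o3 = w e3 \<or>
        w o2 = w e3 \<and> w o3 = w e3"
      by (rule not_lonely) (fact nz | rule ne'(1); simp)+
    then show "w e3 = w e1 \<or> w e3 = w e2 \<or> w e3 = w o1 \<and> w e3 = w o2 \<or> w e3 = w o1 \<and> w e3 = w o3 \<or>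
        w e3 = w o2 \<and> w e3 = w o3"
      by metis
    have "o1 + (if w o2 = w o1 then o2 else 0) + (if w o3 = w o1 then o3 else 0) =
        (if w e1 = w o1 then e1 else 0) + (if w e2 = w o1 then e2 else 0) + (if w e3 = w o1 then e3 else 0)"
      using cls[OF le(4), unfolded u, symmetric] by (simp only: refl if_True add_ac)
    then have "w o2 = w o1 \<or> w o3 = w o1 \<or> w e1 = w o1 \<and> w e2 = w o1 \<or> w e1 = w o1 \<and> w e3 = w o1 \<or>
        w e2 = w o1 \<and> w e3 = w o1"
      by (rule not_lonely) (fact nz | rule ne'(2); simp)+
    then show "w o1 = w o2 \<or> w o1 = w o3 \<or> w o1 = w e1 \<and> w o1 = w e2 \<or> w o1 = w e1 \<and> w o1 = w e3 \<or>
        w o1 = w e2 \<and> w o1 = w e3"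
      by metis
    have "o2 + (if w o1 = w o2 then o1 else 0) + (if w o3 = w o2 then o3 else 0) =
        (if w e1 = w o2 then e1 else 0) + (if w e2 = w o2 then e2 else 0) + (if w e3 = w o2 then e3 else 0)"
      using cls[OF le(5), unfolded u, symmetric] by (simp only: refl if_True add_ac)
    then have "w o1 = w o2 \<or> w o3 = w o2 \<or> w e1 = w o2 \<and> w e2 = w o2 \<or> w e1 = w o2 \<and> w e3 = w o2 \<or>
        w e2 = w o2 \<and> w e3 = w o2"
      by (rule not_lonely) (fact nz | rule ne'(2); simp)+
    then show "w o2 = w o1 \<or> w o2 = w o3 \<or> w o2 = w e1 \<and> w o2 = w e2 \<or> w o2 = w e1 \<and> w o2 = w e3 \<or>
        w o2 = w e2 \<and> w o2 = w e3"
      by metis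
    have "o3 + (if w o1 = w o3 then o1 else 0) + (if w o2 = w o3 then o2 else 0) =
        (if w e1 = w o3 then e1 else 0) + (if w e2 = w o3 then e2 else 0) + (if w e3 = w o3 then e3 else 0)"
      using cls[OF le(6), unfolded u, symmetric] by (simp only: refl if_True add_ac)
    then have "w o1 = w o3 \<or> w o2 = w o3 \<or> w e1 = w o3 \<and> w e2 = w o3 \<or> w e1 = w o3 \<and> w e3 = w o3 \<or>
        w e2 = w o3 \<and> w e3 = w o3"
      by (rule not_lonely) (fact nz | rule ne'(2); simp)+
    then show "w o3 = w o1 \<or> w o3 = w o2 \<or> w o3 = w e1 \<and> w o3 = w e2 \<or> w o3 = w e1 \<and> w o3 = w e3 \<or>
        w o3 = w e2 \<and> w o3 = w e3"
      by metis
  qed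
  then show ?thesis using p by (auto simp: proportional_def w_def)
qed

text \<open>The assumption \<open>sum\<close> says that the columns p, q and (1, 1, 1) have
  determinant zero. For columns with entries a_i * b0 + n and a_i * b1 + n this holds since b1 * p -
  b0 * q is n * (b1 - b0) times (1, 1, 1). Each minor has the order of a product of two entries,
  hence a multiple of \<open>k\<close>, and the resulting linear equations between orders can be
  solved.\<close>

lemma columns_proportional:
  fixes p0 p1 p2 q0 q1 q2 :: "'a :: {alg_closed_field, field_char_0} poly"
  assumes k: "k \<ge> 18"
    and dvd: "\<And>r p. p \<in> {p0, p1, p2, q0, q1, q2} \<Longrightarrow> k dvd order r p"
    and nz: "p0 \<noteq> 0" "p1 \<noteq> 0" "p2 \<noteq> 0" "q0 \<noteq> 0" "q1 \<noteq> 0" "q2 \<noteq> 0"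
    and minors: "proportional (p0 * q1) (p1 * q0)" "proportional (p1 * q2) (p2 * q1)"
      "proportional (p2 * q0) (p0 * q2)"
    and ne: "p0 * q1 \<noteq> p1 * q0" "p1 * q2 \<noteq> p2 * q1" "p2 * q0 \<noteq> p0 * q2"
    and sum: "(p0 * q1 - p1 * q0) + (p1 * q2 - p2 * q1) + (p2 * q0 - p0 * q2) = 0"
  shows "proportional p0 p1 \<and> proportional q0 q1"
proof -
  let ?d0 = "p0 * q1 - p1 * q0" and ?d1 = "p1 * q2 - p2 * q1" and ?d2 = "p2 * q0 - p0 * q2"
  have d: "proportional ?d0 (p1 * q0)" "proportional ?d1 (p2 * q1)" "proportional ?d2 (p0 * q2)"
    using minors ne nz by (simp_all add: proportional_diff)
  have o: "order r ?d0 = order r p1 + order r q0" "order r ?d1 = order r p2 + order r q1"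
    "order r ?d2 = order r p0 + order r q2" for r
    using d nz by (simp_all add: proportional_def order_mult)
  have m: "order r p0 + order r q1 = order r p1 + order r q0"
    "order r p1 + order r q2 = order r p2 + order r q1"
    "order r p2 + order r q0 = order r p0 + order r q2" for r
    using minors nz by (simp_all add: proportional_def order_mult)
  have "proportional ?d1 ?d0 \<and> proportional ?d2 ?d0"
  proof (rule three_terms_proportional[OF k])
    show "?d0 \<noteq> 0" "?d1 \<noteq> 0" "?d2 \<noteq> 0" using ne by simp_all
    show "k dvd order r ?d0" "k dvd order r ?d1" "k dvd order r ?d2" for r
      unfolding o by (rule dvd_add; rule dvd; simp)+
  qed (fact sum)
  then have e: "order r p2 + order r q1 = order r p1 + order r q0"
    "order r p0 + order r q2 = order r p1 + order r q0" for r
    using o by (simp_all add: proportional_def)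
  have "order r p0 = order r p1 \<and> order r q0 = order r q1" for r
    using m[of r] e[of r] by linarith
  then show ?thesis by (simp_all add: proportional_def)
qed

section \<open>Three rows and three columns of shifted products\<close>

lemma k_dvd_order_nth_power:
  fixes p :: "'a :: idom poly"
  assumes "is_nth_power k p" "p \<noteq> 0" "k > 0"
  shows "k dvd order r p"
proof -
  obtain q where q: "p = q ^ k" using assms(1) by (auto simp: is_nth_power_def)
  then have "q \<noteq> 0" using assms(2,3) by auto
  then show ?thesis by (simp add: q order_power)
qed

text \<open>\<open>?e1\<close> to \<open>?e3\<close> are the even and \<open>?o1\<close> to
  \<open>?o3\<close> the odd terms of the determinant. Rows and columns are treated symmetrically
  after the six terms are known to be proportional.\<close>

lemma entries_proportional:
  fixes n :: "'a :: {alg_closed_field, field_char_0} poly"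
  assumes k: "k \<ge> 18" and n: "n \<noteq> 0"
    and a: "a0 \<noteq> a1" "a1 \<noteq> a2" "a0 \<noteq> a2" and b: "b0 \<noteq> b1" "b1 \<noteq> b2" "b0 \<noteq> b2"
    and X: "\<And>s t. s \<in> {a0, a1, a2} \<Longrightarrow> t \<in> {b0, b1, b2} \<Longrightarrow> 
      s * t + n \<noteq> 0 \<and> is_nth_power k (s * t + n)"
  shows "proportional (a0 * b0 + n) (a1 * b0 + n)" "proportional (a0 * b1 + n) (a1 * b1 + n)"
    "proportional (a0 * b0 + n) (a0 * b1 + n)"
proof -
  define M where "M s t = s * t + n" for s t
  have nz: "M s t \<noteq> 0" if "s \<in> {a0, a1, a2}" "t \<in> {b0, b1, b2}" for s t
    using X[OF that] by (simp add: M_def)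
  have dvd: "k dvd order r (M s t)" if "s \<in> {a0, a1, a2}" "t \<in> {b0, b1, b2}" for r s t
    using X[OF that] k by (auto simp: M_def intro: k_dvd_order_nth_power)
  have minor: "M s t * M s' t' - M s' t * M s t' = n * (s - s') * (t - t')" for s s' t t'
    by (simp add: M_def algebra_simps)
  have minor_ne: "M s t * M s' t' \<noteq> M s' t * M s t'" if "s \<noteq> s'" "t \<noteq> t'" for s s' t t'
  proof -
    have "n * (s - s') * (t - t') \<noteq> 0" using n that by simp
    then show ?thesis unfolding minor[symmetric] by auto
  qed
  let ?e1 = "M a0 b0 * M a1 b1 * M a2 b2" and ?e2 = "M a0 b1 * M a1 b2 * M a2 b0"
    and ?e3 = "M a0 b2 * M a1 b0 * M a2 b1" and ?o1 = "M a0 b0 * M a1 b2 * M a2 b1"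
    and ?o2 = "M a0 b1 * M a1 b0 * M a2 b2" and ?o3 = "M a0 b2 * M a1 b1 * M a2 b0"
  have six: "proportional p ?e1" if "p \<in> {?e2, ?e3, ?o1, ?o2, ?o3}" for p
  proof (rule six_terms_proportional[OF k _ _ _ _ _ _ _ _ _ _ that])
    show "?e1 \<noteq> 0" "?e2 \<noteq> 0" "?e3 \<noteq> 0" "?o1 \<noteq> 0" "?o2 \<noteq> 0" "?o3 \<noteq> 0"
      by (simp_all add: nz)
    show "?e1 + ?e2 + ?e3 = ?o1 + ?o2 + ?o3" by (simp add: M_def algebra_simps)
    show "?e1 * ?e2 * ?e3 = ?o1 * ?o2 * ?o3" by (simp only: mult_ac)
    show "k dvd order r p" if "p \<in> {?e1, ?e2, ?e3, ?o1, ?o2, ?o3}" for r p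
      using that by (elim insertE emptyE) (simp_all add: order_mult nz dvd)
    show "p \<noteq> q" if pq: "p \<in> {?e1, ?e2, ?e3}" "q \<in> {?o1, ?o2, ?o3}" for p q
    proof -
      note ne = minor_ne[OF a(1) b(1)] minor_ne[OF a(1) b(2)] minor_ne[OF a(1) b(3)]
        minor_ne[OF a(2) b(1)] minor_ne[OF a(2) b(2)] minor_ne[OF a(2) b(3)]
        minor_ne[OF a(3) b(1)] minor_ne[OF a(3) b(2)] minor_ne[OF a(3) b(3)]
      \<comment> \<open>An even and an odd permutation of three points agree in exactly one place,
        so the difference is an entry times a 2 x 2 minor, and minors are n * (s - s') * (t -
        t').\<close>
      have "?e1 - ?o1 = M a0 b0 * (M a1 b1 * M a2 b2 - M a2 b1 * M a1 b2)"
        "?e1 - ?o2 = M a2 b2 * (M a0 b0 * M a1 b1 - M a1 b0 * M a0 b1)"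
        "?e1 - ?o3 = M a1 b1 * (M a0 b0 * M a2 b2 - M a2 b0 * M a0 b2)"
        "?e2 - ?o1 = M a1 b2 * (M a2 b0 * M a0 b1 - M a0 b0 * M a2 b1)"
        "?e2 - ?o2 = M a0 b1 * (M a2 b0 * M a1 b2 - M a1 b0 * M a2 b2)"
        "?e2 - ?o3 = M a2 b0 * (M a0 b1 * M a1 b2 - M a1 b1 * M a0 b2)"
        "?e3 - ?o1 = M a2 b1 * (M a1 b0 * M a0 b2 - M a0 b0 * M a1 b2)"
        "?e3 - ?o2 = M a1 b0 * (M a2 b1 * M a0 b2 - M a0 b1 * M a2 b2)"
        "?e3 - ?o3 = M a0 b2 * (M a1 b0 * M a2 b1 - M a2 b0 * M a1 b1)"
        by (simp_all add: algebra_simps)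
      then have "p - q \<noteq> 0"
        using pq by (elim insertE emptyE) (simp_all add: minor nz n a b a[symmetric] b[symmetric])
      then show ?thesis by auto
    qed
  qed
  have six_order: "order r ?e2 = order r ?e1" "order r ?e3 = order r ?e1" "order r ?o1 = order r ?e1"
    "order r ?o2 = order r ?e1" "order r ?o3 = order r ?e1" for r
    using six by (simp_all add: proportional_def)
  \<comment> \<open>Multiplying both sides by the entry in the complementary row and column gives
    one even and one odd term.\<close>
  have P: "proportional (M s t * M s' t') (M s' t * M s t')" 
    if "s \<in> {a0, a1, a2}" "s' \<in> {a0, a1, a2}" "t \<in> {b0, b1, b2}" "t' \<in> {b0, b1, b2}" for s s' t t'
  proof -
    have "order r (M s t) + order r (M s' t') = order r (M s' t) + order r (M s t')" for r
      using that six_order[of r] by (elim insertE emptyE; simp add: order_mult nz)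
    then show ?thesis using that by (simp add: proportional_def order_mult nz)
  qed
  have "proportional (M a0 b0) (M a1 b0) \<and> proportional (M a0 b1) (M a1 b1)"
  proof (rule columns_proportional[OF k])
    show "k dvd order r p" if "p \<in> {M a0 b0, M a1 b0, M a2 b0, M a0 b1, M a1 b1, M a2 b1}" for r p
      using that by (elim insertE emptyE) (simp_all add: dvd)
    show "M a0 b0 * M a1 b1 - M a1 b0 * M a0 b1 + (M a1 b0 * M a2 b1 - M a2 b0 * M a1 b1) +
      (M a2 b0 * M a0 b1 - M a0 b0 * M a2 b1) = 0" by (simp add: M_def algebra_simps)
    show "M a0 b0 * M a1 b1 \<noteq> M a1 b0 * M a0 b1" "M a1 b0 * M a2 b1 \<noteq> M a2 b0 * M a1 b1"
      "M a2 b0 * M a0 b1 \<noteq> M a0 b0 * M a2 b1"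
      by (rule minor_ne; simp add: a b a[symmetric] b[symmetric])+
  qed (simp_all add: P nz)
  then show "proportional (a0 * b0 + n) (a1 * b0 + n)" "proportional (a0 * b1 + n) (a1 * b1 + n)"
    by (simp_all add: M_def)
  have minor_ne': "M s t * M s' t' \<noteq> M s t' * M s' t" if "s \<noteq> s'" "t \<noteq> t'" for s s' t t'
    using minor_ne[OF that] by (simp add: mult.commute[of "M s t'"])
  have P': "proportional (M s t * M s' t') (M s t' * M s' t)" 
    if "s \<in> {a0, a1, a2}" "s' \<in> {a0, a1, a2}" "t \<in> {b0, b1, b2}" "t' \<in> {b0, b1, b2}" for s s' t t'
    using P[OF that] by (simp only: mult.commute[of "M s t'"])
  have "proportional (M a0 b0) (M a0 b1) \<and> proportional (M a1 b0) (M a1 b1)"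
  proof (rule columns_proportional[OF k])
    show "k dvd order r p" if "p \<in> {M a0 b0, M a0 b1, M a0 b2, M a1 b0, M a1 b1, M a1 b2}" for r p
      using that by (elim insertE emptyE) (simp_all add: dvd)
    show "M a0 b0 * M a1 b1 - M a0 b1 * M a1 b0 + (M a0 b1 * M a1 b2 - M a0 b2 * M a1 b1) +
      (M a0 b2 * M a1 b0 - M a0 b0 * M a1 b2) = 0" by (simp add: M_def algebra_simps)
    show "M a0 b0 * M a1 b1 \<noteq> M a0 b1 * M a1 b0" "M a0 b1 * M a1 b2 \<noteq> M a0 b2 * M a1 b1"
      "M a0 b2 * M a1 b0 \<noteq> M a0 b0 * M a1 b2"
      by (rule minor_ne'; simp add: a b a[symmetric] b[symmetric])+
  qed (simp_all add: P' nz)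
  then show "proportional (a0 * b0 + n) (a0 * b1 + n)" by (simp add: M_def)
qed

text \<open>Differences of proportional entries stay in the class: a0 * (b1 - b0) and a1 * (b0 - b1)
  lie in that of \<open>x\<close>, whence \<open>a0\<close> and \<open>a1\<close> are proportional.
  Then b0 * (a0 - a1) puts a0 * b0 into it, and finally n = x - a0 * b0.\<close>

lemma split_proportional:
  fixes n :: "'a :: {alg_closed_field, field_char_0} poly"
  assumes k: "k \<ge> 18" and n: "n \<noteq> 0"
    and a: "a0 \<noteq> a1" "a1 \<noteq> a2" "a0 \<noteq> a2" and b: "b0 \<noteq> b1" "b1 \<noteq> b2" "b0 \<noteq> b2"
    and nz: "a0 \<noteq> 0" "a1 \<noteq> 0" "b0 \<noteq> 0"
    and X: "\<And>s t. s \<in> {a0, a1, a2} \<Longrightarrow> t \<in> {b0, b1, b2} \<Longrightarrow> 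
      s * t + n \<noteq> 0 \<and> is_nth_power k (s * t + n)"
  shows "proportional a0 a1 \<and> proportional n (a0 * b0) \<and> proportional n (a0 * b0 + n)"
proof -
  define x where "x = a0 * b0 + n"
  have pr: "proportional x (a1 * b0 + n)" "proportional (a0 * b1 + n) (a1 * b1 + n)"
    "proportional x (a0 * b1 + n)"
    using entries_proportional[OF k n a b X] by (simp_all add: x_def)
  have x0: "x \<noteq> 0" "a1 * b0 + n \<noteq> 0" "a0 * b1 + n \<noteq> 0" "a1 * b1 + n \<noteq> 0" using X by (simp_all add: x_def)
  have "proportional (a0 * (b1 - b0)) x"
  proof -
    have "proportional ((a0 * b1 + n) - x) x"
      using pr(3) x0 nz b by (intro proportional_diff) (auto simp: x_def proportional_sym)
    then show ?thesis by (simp add: x_def algebra_simps)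
  qed
  moreover have "proportional (a1 * (b0 - b1)) (a1 * b1 + n)"
  proof -
    have "proportional (a1 * b0 + n) (a1 * b1 + n)"
      using pr proportional_trans proportional_sym by metis
    then have "proportional ((a1 * b0 + n) - (a1 * b1 + n)) (a1 * b1 + n)"
      using x0 nz b by (intro proportional_diff) auto
    then show ?thesis by (simp add: algebra_simps)
  qed
  moreover have "order r (b0 - b1) = order r (b1 - b0)" for r
    using order_uminus[of r "b0 - b1"] by simp
  moreover have "order r (a1 * b1 + n) = order r x" for r
    using pr by (simp add: proportional_def)
  ultimately have "order r a0 + order r (b1 - b0) = order r a1 + order r (b1 - b0)" for r
    using nz b by (simp add: proportional_def order_mult)
  then have a01: "proportional a0 a1" by (simp add: proportional_def)
  then have "proportional (a0 - a1) a1" using nz a by (intro proportional_diff) auto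
  moreover have "proportional (b0 * (a0 - a1)) (a1 * b0 + n)"
  proof -
    have "proportional (x - (a1 * b0 + n)) (a1 * b0 + n)"
      using pr(1) x0 nz a by (intro proportional_diff) (auto simp: x_def)
    then show ?thesis by (simp add: x_def algebra_simps)
  qed
  ultimately have ab: "proportional (a0 * b0) x"
    using a01 pr(1) nz a by (simp add: proportional_def order_mult add.commute)
  then have "proportional (x - a0 * b0) (a0 * b0)"
    using nz n x0 by (intro proportional_diff) (auto simp: x_def proportional_sym)
  then have "proportional n (a0 * b0)" by (simp add: x_def)
  then show ?thesis using a01 ab proportional_trans unfolding x_def by blast
qed

section \<open>Transfer of powers and a criterion for squares\<close>

lemma is_nth_power_proportional:
  fixes p q :: "'a :: alg_closed_field poly"
  assumes "proportional p q" "p \<noteq> 0" "q \<noteq> 0" "is_nth_power k q" "k > 0"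
  shows "is_nth_power k p"
proof -
  obtain c where c: "p = smult c q" using assms by (auto elim: proportionalE)
  obtain y where y: "q = y ^ k" using assms by (auto simp: is_nth_power_def)
  obtain e where "e ^ k = c" using nth_root_exists[OF \<open>k > 0\<close>] by blast
  then have "p = smult e y ^ k" by (simp add: c y smult_power)
  then show ?thesis by (auto simp: is_nth_power_def)
qed

lemma is_square_if_even_power: "is_nth_power k p \<Longrightarrow> even k \<Longrightarrow> is_square p"
  by (auto simp: is_nth_power_def elim!: evenE) (metis mult.commute power_mult)

text \<open>With n = -x * y = -z * t one gets z * (x * t + n) = n * (z - x), x * (y * z + n) = n *
  (x - z), and the same with z and t exchanged. Multiplying all four shows that z * t = -n times a
  nonzero square is a square, and -1 is a square.\<close>

lemma is_square_if_two_zero_pairs: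
  fixes n :: "'a :: {alg_closed_field, field_char_0} poly"
  assumes n: "n \<noteq> 0" and pairs: "x * y + n = 0" "z * t + n = 0" and "x \<noteq> z" "x \<noteq> t"
    and sq: "is_square (x * z + n)" "is_square (x * t + n)" "is_square (y * z + n)" "is_square (y * t + n)"
  shows "is_square n"
proof -
  obtain f g h l where f: "x * z + n = f\<^sup>2" "x * t + n = g\<^sup>2" "y * z + n = h\<^sup>2" "y * t + n = l\<^sup>2"
    using sq unfolding is_nth_power_def by blast
  have n': "n = - (x * y)" "n = - (z * t)" using pairs by (simp_all add: eq_neg_iff_add_eq_0 add.commute)
  have "(z * g\<^sup>2) * (x * h\<^sup>2) = - (n\<^sup>2 * (x - z)\<^sup>2)"
  proof -
    have 1: "z * g\<^sup>2 = n * (z - x)"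
    proof -
      have "z * (x * t + n) = x * (z * t) + n * z" by (simp add: algebra_simps)
      also have "z * t = - n" using n'(2) by simp
      finally show ?thesis unfolding f by (simp add: algebra_simps)
    qed
    have 2: "x * h\<^sup>2 = n * (x - z)"
    proof -
      have "x * (y * z + n) = z * (x * y) + n * x" by (simp add: algebra_simps)
      also have "x * y = - n" using n'(1) by simp
      finally show ?thesis unfolding f by (simp add: algebra_simps)
    qed
    show ?thesis unfolding 1 2 by (simp add: power2_eq_square algebra_simps)
  qed
  moreover have "(t * f\<^sup>2) * (x * l\<^sup>2) = - (n\<^sup>2 * (x - t)\<^sup>2)"
  proof -
    have 1: "t * f\<^sup>2 = n * (t - x)"
    proof -
      have "t * (x * z + n) = x * (z * t) + n * t" by (simp add: algebra_simps)
      also have "z * t = - n" using n'(2) by simp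
      finally show ?thesis unfolding f by (simp add: algebra_simps)
    qed
    have 2: "x * l\<^sup>2 = n * (x - t)"
    proof -
      have "x * (y * t + n) = t * (x * y) + n * x" by (simp add: algebra_simps)
      also have "x * y = - n" using n'(1) by simp
      finally show ?thesis unfolding f by (simp add: algebra_simps)
    qed
    show ?thesis unfolding 1 2 by (simp add: power2_eq_square algebra_simps)
  qed
  ultimately have "((z * g\<^sup>2) * (x * h\<^sup>2)) * ((t * f\<^sup>2) * (x * l\<^sup>2)) = (n\<^sup>2 * (x - z)\<^sup>2) * (n\<^sup>2 * (x - t)\<^sup>2)"
    by simp
  also have "((z * g\<^sup>2) * (x * h\<^sup>2)) * ((t * f\<^sup>2) * (x * l\<^sup>2)) = (z * t) * (x * f * g * h * l)\<^sup>2"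
    by (simp add: power2_eq_square algebra_simps)
  also have "z * t = - n" using n'(2) by simp
  finally have eq: "- n * (x * f * g * h * l)\<^sup>2 = (n\<^sup>2 * (x - z) * (x - t))\<^sup>2"
    by (simp add: power2_eq_square algebra_simps)
  define u v where "u = x * f * g * h * l" and "v = n\<^sup>2 * (x - z) * (x - t)"
  have "v \<noteq> 0" using assms by (simp add: v_def)
  have eq: "- n * u\<^sup>2 = v\<^sup>2" using eq by (simp add: u_def v_def)
  with \<open>v \<noteq> 0\<close> have "u \<noteq> 0" by auto
  have "u dvd v"
  proof (rule dvd_if_order_le)
    fix r
    have "u\<^sup>2 dvd v\<^sup>2" unfolding eq[symmetric] by simp
    then have "order r (u\<^sup>2) \<le> order r (v\<^sup>2)"
      using \<open>v \<noteq> 0\<close> by (intro dvd_imp_order_le) simp_all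
    then show "order r u \<le> order r v" using \<open>u \<noteq> 0\<close> \<open>v \<noteq> 0\<close> by (simp add: order_power)
  qed fact
  then obtain w where "v = u * w" by (elim dvdE)
  then have "- n * u\<^sup>2 = w\<^sup>2 * u\<^sup>2" using eq by (simp add: power_mult_distrib mult.commute)
  then have "- n = w\<^sup>2" using \<open>u \<noteq> 0\<close> by (metis mult_right_cancel power_not_zero)
  moreover obtain i :: 'a where "i\<^sup>2 = -1" using nth_root_exists[of 2 "-1 :: 'a"] by auto
  ultimately have "n = (smult i w)\<^sup>2" by (simp add: smult_power) (metis minus_minus)
  then show ?thesis by (auto simp: is_nth_power_def)
qed

section \<open>Choosing rows and columns\<close>

lemma unique_partner: "\<exists>b. \<forall>t. s * t + n = 0 \<longrightarrow> t = b"
  if "n \<noteq> 0" for s n :: "'a :: idom"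
proof (cases "\<exists>t. s * t + n = 0")
  case True
  then obtain b where b: "s * b + n = 0" by blast
  then have "s \<noteq> 0" using that by auto
  have "t = b" if "s * t + n = 0" for t
  proof -
    have "s * t = s * b" using that b by (simp add: add_eq_0_iff2)
    then show ?thesis using \<open>s \<noteq> 0\<close> by simp
  qed
  then show ?thesis by blast
qed blast

text \<open>Only the rows \<open>x\<close>, \<open>y\<close> and the column \<open>u\<close> have to
  be nonzero, so the zero polynomial may still serve as \<open>z\<close> or as one of the other
  columns.\<close>

lemma tuple_split:
  fixes n :: "'a :: {alg_closed_field, field_char_0} poly"
  assumes k: "k \<ge> 18" and n: "n \<noteq> 0" and A: "diophantine_tuple k n A"
    and T: "finite T" "card T \<ge> 3" "T \<subseteq> A"
    and xyz: "x \<in> A - T" "y \<in> A - T" "z \<in> A - T" "x \<noteq> y" "y \<noteq> z" "x \<noteq> z" "x \<noteq> 0" "y \<noteq> 0"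
    and cross: "\<And>s t. s \<in> {x, y, z} \<Longrightarrow> t \<in> T \<Longrightarrow> s * t + n \<noteq> 0"
  obtains u where "u \<in> T" "u \<noteq> 0" "proportional x y" "proportional n (x * u)" "is_nth_power k n"
proof -
  have "card (T - {0}) \<ge> 2" using T(1,2) by (auto simp: card_Diff_singleton_if)
  then obtain u where u: "u \<in> T" "u \<noteq> 0" by (metis Diff_eq_empty_iff card.empty not_numeral_le_zero insertCI subsetI singletonD)
  have "card (T - {u}) \<ge> 2" using T(1,2) by (auto simp: card_Diff_singleton_if)
  then obtain V where V: "V \<subseteq> T - {u}" "card V = 2" by (metis obtain_subset_with_card_n)
  then obtain v w where vw: "V = {v, w}" "v \<noteq> w" by (auto simp: card_2_iff)
  have "proportional x y \<and> proportional n (x * u) \<and> proportional n (x * u + n)"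
  proof (rule split_proportional[OF k n xyz(4,5,6)])
    show "u \<noteq> v" "v \<noteq> w" "u \<noteq> w" using V vw by auto
    fix s t assume s: "s \<in> {x, y, z}" and t: "t \<in> {u, v, w}"
    then have "t \<in> T" using u V vw by auto
    moreover from this have "s \<in> A" "t \<in> A" "s \<noteq> t" using s xyz T by auto
    ultimately show "s * t + n \<noteq> 0 \<and> is_nth_power k (s * t + n)"
      using cross s A by (auto simp: diophantine_tuple_def)
  qed (use xyz u in auto)
  moreover have "is_nth_power k (x * u + n)"
  proof -
    have "x \<noteq> u" "x \<in> A" "u \<in> A" using xyz(1) u(1) T(3) by auto
    then show ?thesis using A by (simp add: diophantine_tuple_def)
  qed
  moreover have "x * u + n \<noteq> 0" using cross u by simp
  ultimately have "is_nth_power k n" using is_nth_power_proportional n k by (metis gr0I not_numeral_le_zero)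
  with \<open>_ \<and> _ \<and> _\<close> u that show ?thesis by blast
qed

text \<open>The zeros \<open>s * t + n = 0\<close> form a partial matching of \<open>A\<close>. Placing the partner of
  \<open>x\<close> or \<open>y\<close>, if there is one, next to them leaves at most one element \<open>b\<close> to avoid.\<close>

lemma third_element:
  fixes n :: "'a :: idom"
  assumes n: "n \<noteq> 0" and xy: "x \<in> A" "y \<in> A" "x \<noteq> y" and "A - {x, y} \<noteq> {}"
  obtains z b where "z \<in> A - {x, y}"
    "\<And>s t. s \<in> {x, y, z} \<Longrightarrow> t \<in> A - {x, y, z} \<Longrightarrow> s * t + n = 0 \<Longrightarrow> t = b"
proof -
  have "\<forall>s. \<exists>b. \<forall>t. s * t + n = 0 \<longrightarrow> t = b" using unique_partner[OF n] by simp
  from choice[OF this] obtain b where "\<forall>s t. s * t + n = 0 \<longrightarrow> t = b s" by (elim exE)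
  then have b: "s * t + n = 0 \<Longrightarrow> t = b s" for s t by simp
  have b': "s * t + n = 0 \<Longrightarrow> s = b t" for s t using b[of t s] by (simp add: mult.commute)
  consider z where "z \<in> A - {x, y}" "x * z + n = 0" | z where "z \<in> A - {x, y}" "y * z + n = 0"
    | z where "z \<in> A - {x, y}" "\<And>t. t \<in> A - {x, y} \<Longrightarrow> x * t + n \<noteq> 0 \<and> y * t + n \<noteq> 0"
    using assms(5) by blast
  then show ?thesis
  proof cases
    case (1 z)
    have "t = b y" if "s \<in> {x, y, z}" "t \<in> A - {x, y, z}" "s * t + n = 0" for s t
    proof -
      have "z = b x" "x = b z" "t = b s" using b[OF 1(2)] b'[OF 1(2)] b[OF that(3)] by this+
      then have "s \<noteq> x" "s \<noteq> z" using that(2) by (metis Diff_iff insertCI)+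
      then show ?thesis using \<open>t = b s\<close> that(1) by blast
    qed
    with 1 that show ?thesis by blast
  next
    case (2 z)
    have "t = b x" if "s \<in> {x, y, z}" "t \<in> A - {x, y, z}" "s * t + n = 0" for s t
    proof -
      have "z = b y" "y = b z" "t = b s" using b[OF 2(2)] b'[OF 2(2)] b[OF that(3)] by this+
      then have "s \<noteq> y" "s \<noteq> z" using that(2) by (metis Diff_iff insertCI)+
      then show ?thesis using \<open>t = b s\<close> that(1) by blast
    qed
    with 2 that show ?thesis by blast
  next
    case (3 z)
    have "t = b z" if "s \<in> {x, y, z}" "t \<in> A - {x, y, z}" "s * t + n = 0" for s t
    proof -
      have "s \<noteq> x" "s \<noteq> y" using that(2,3) 3(2)[of t] by auto
      then show ?thesis using b[OF that(3)] that(1) by blast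
    qed
    with 3 that show ?thesis by blast
  qed
qed

text \<open>Seven is 3 + 1 + 3: the rows, one element \<open>b\<close> to avoid, and the columns.
  The finite \<open>B\<close> is separate from \<open>A\<close> because finiteness of
  \<open>A\<close> is not yet known, and \<open>x\<close>, \<open>y\<close> may be any nonzero
  elements of \<open>A\<close>.\<close>

lemma seven_elements:
  fixes n :: "'a :: {alg_closed_field, field_char_0} poly"
  assumes k: "k \<ge> 18" and n: "n \<noteq> 0" and A: "diophantine_tuple k n A"
    and B: "B \<subseteq> A" "finite B" "card B \<ge> 7"
    and xy: "x \<in> A" "y \<in> A" "x \<noteq> y" "x \<noteq> 0" "y \<noteq> 0"
  obtains u where "u \<in> A" "u \<noteq> 0" "proportional x y" "proportional n (x * u)" "is_nth_power k n"
proof -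
  have card: "card (B - S) \<ge> 7 - card S" if "finite S" for S
    using diff_card_le_card_Diff[OF that, of B] B(3) by linarith
  have "card (B - {x, y}) \<ge> 7 - 2" using card[of "{x, y}"] xy by simp
  then have "card (B - {x, y}) \<noteq> 0" by simp
  then have "B - {x, y} \<noteq> {}" by (metis card.empty)
  then have "A - {x, y} \<noteq> {}" using B(1) by blast
  then obtain z b where z: "z \<in> A - {x, y}"
    and b: "\<And>s t. s \<in> {x, y, z} \<Longrightarrow> t \<in> A - {x, y, z} \<Longrightarrow> s * t + n = 0 \<Longrightarrow> t = b"
    using third_element[OF n xy(1-3)] by blast
  let ?T = "B - {x, y, z, b}"
  have "card {x, y, z, b} \<le> 4" by (simp add: card_insert_if)
  then have "card ?T \<ge> 3" using card[of "{x, y, z, b}"] by simp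
  moreover have "s * t + n \<noteq> 0" if "s \<in> {x, y, z}" "t \<in> ?T" for s t
    using b[of s t] that B(1) by auto
  moreover have "finite ?T" "?T \<subseteq> A" "x \<in> A - ?T" "y \<in> A - ?T" "z \<in> A - ?T" "y \<noteq> z" "x \<noteq> z"
    using B xy z by auto
  ultimately obtain u where "u \<in> ?T" "u \<noteq> 0" "proportional x y" "proportional n (x * u)" "is_nth_power k n"
    using xy by (elim tuple_split[OF k n A, of ?T x y z]) blast+
  then show ?thesis using B(1) that by blast
qed

text \<open>For even \<open>k\<close> all entries are squares, so a nonsquare \<open>n\<close>
  allows at most one vanishing pair. Taking both its members as rows leaves nothing to avoid, and 3
  + 3 elements suffice to make \<open>n\<close> a \<open>k\<close>-th power, hence a square.\<close>

lemma six_elements: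
  fixes n :: "'a :: {alg_closed_field, field_char_0} poly"
  assumes k: "k \<ge> 18" and n: "n \<noteq> 0" and A: "diophantine_tuple k n A"
    and card: "card A = 6" and "even k"
  shows "is_square n"
proof (rule ccontr)
  assume nsq: "\<not> is_square n"
  have fin: "finite A" using card by (metis card.infinite zero_neq_numeral)
  have sq: "is_square (s * t + n)" if "s \<in> A" "t \<in> A" "s \<noteq> t" for s t
    using that A \<open>even k\<close> is_square_if_even_power by (auto simp: diophantine_tuple_def)
  \<comment> \<open>A vanishing pair if there is one, otherwise any two nonzero elements.\<close>
  obtain x y where xy: "x \<in> A" "y \<in> A" "x \<noteq> y" "x \<noteq> 0" "y \<noteq> 0"
    and pair: "\<And>s t. s \<in> A \<Longrightarrow> t \<in> A \<Longrightarrow> s \<noteq> t \<Longrightarrow> s * t + n = 0 \<Longrightarrow> {s, t} \<inter> {x, y} \<noteq> {} \<Longrightarrow> {s, t} = {x, y}"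
    and pair': "(\<exists>s\<in>A. \<exists>t\<in>A. s \<noteq> t \<and> s * t + n = 0) \<Longrightarrow> x * y + n = 0"
  proof (cases "\<exists>s\<in>A. \<exists>t\<in>A. s \<noteq> t \<and> s * t + n = 0")
    case True
    then obtain x y where xy: "x \<in> A" "y \<in> A" "x \<noteq> y" "x * y + n = 0" by blast
    then have "x \<noteq> 0" "y \<noteq> 0" using n by auto
    obtain bx where bx: "\<And>t. x * t + n = 0 \<Longrightarrow> t = bx" using unique_partner[OF n] by blast
    obtain b_y where b_y: "\<And>t. y * t + n = 0 \<Longrightarrow> t = b_y" using unique_partner[OF n] by blast
    have bxy: "bx = y" "b_y = x" using bx[of y] b_y[of x] xy(4) by (simp_all add: mult.commute)
    have *: "{s, t} = {x, y}" if "s * t + n = 0" "s \<in> {x, y}" for s t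
    proof (cases "s = x")
      case True
      then show ?thesis using bx[of t] bxy that by simp
    next
      case False
      then have "s = y" using that by simp
      then show ?thesis using b_y[of t] bxy that by (simp add: insert_commute)
    qed
    have "{s, t} = {x, y}" if "s * t + n = 0" "{s, t} \<inter> {x, y} \<noteq> {}" for s t
    proof (cases "s \<in> {x, y}")
      case True
      then show ?thesis using * that by blast
    next
      case False
      then have "t \<in> {x, y}" using that(2) by blast
      then have "{t, s} = {x, y}" using *[of t s] that(1) by (simp only: mult.commute)
      then show ?thesis by (simp only: insert_commute)
    qed
    with that[OF xy(1,2,3) \<open>x \<noteq> 0\<close> \<open>y \<noteq> 0\<close>] xy(4) show ?thesis by blast
  next
    case False
    have "card (A - {0}) \<ge> 2" using fin card by (auto simp: card_Diff_singleton_if)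
    then obtain V where V: "V \<subseteq> A - {0}" "card V = 2" by (metis obtain_subset_with_card_n)
    then obtain x y where "V = {x, y}" "x \<noteq> y" by (auto simp: card_2_iff)
    then show ?thesis using that[of x y] V False by blast
  qed
  have card': "card (A - S) = 6 - card S" if "S \<subseteq> A" for S
    using card_Diff_subset[of S A] that fin card finite_subset by metis
  have "card (A - {x, y}) = 4" using card'[of "{x, y}"] xy by simp
  then have "A - {x, y} \<noteq> {}" by (metis card.empty zero_neq_numeral)
  then obtain z where z: "z \<in> A" "z \<noteq> x" "z \<noteq> y" by blast
  let ?T = "A - {x, y, z}"
  have "card ?T = 3" using card'[of "{x, y, z}"] xy z by simp
  moreover have "s * t + n \<noteq> 0" if s: "s \<in> {x, y, z}" and t: "t \<in> ?T" for s t
  proof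
    assume st: "s * t + n = 0"
    have mem: "s \<in> A" "t \<in> A" "s \<noteq> t" using s t xy z by auto
    then have "x * y + n = 0" using st pair' by blast
    moreover have "{s, t} \<inter> {x, y} = {}" using pair[OF mem st] t by auto
    ultimately have "is_square n"
      using st n mem xy sq by (intro is_square_if_two_zero_pairs[of n x y s t]) auto
    then show False using nsq by blast
  qed
  moreover have "finite ?T" "?T \<subseteq> A" "x \<in> A - ?T" "y \<in> A - ?T" "z \<in> A - ?T" "y \<noteq> z" "x \<noteq> z"
    using fin xy z by auto
  ultimately have "is_nth_power k n"
    using xy by (elim tuple_split[OF k n A, of ?T x y z]) simp_all
  then show False using nsq is_square_if_even_power \<open>even k\<close> by blast
qed

section \<open>The cardinality bounds\<close>

theorem theorem1p1:
  fixes k :: nat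
    and n :: "'a :: {alg_closed_field, field_char_0} poly"
    and A :: "'a poly set"
  assumes "k \<ge> 18"
    and "n \<noteq> 0"
    and "diophantine_tuple k n A"
    and "\<And>s. n = s ^ 2 \<Longrightarrow> is_nth_power k n \<Longrightarrow> \<not> A \<subseteq> {smult c s | c. True}"
  shows "finite A \<and> card A \<le> 6 \<and> (\<not> is_square n \<and> even k \<longrightarrow> card A \<le> 5)"
proof -
  have main: "finite A \<and> card A \<le> 6"
  proof (rule ccontr)
    assume *: "\<not> (finite A \<and> card A \<le> 6)"
    obtain B where B: "B \<subseteq> A" "finite B" "card B = 7"
    proof (cases "finite A")
      case True
      then have "7 \<le> card A" using * by simp
      then show ?thesis using that obtain_subset_with_card_n by metis
    next
      case False
      then show ?thesis using that infinite_arbitrarily_large by metis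
    qed
    have "card (B - {0}) \<ge> 2" using B by (auto simp: card_Diff_singleton_if)
    then obtain V where V: "V \<subseteq> B - {0}" "card V = 2" by (metis obtain_subset_with_card_n)
    then obtain x y where "V = {x, y}" "x \<noteq> y" by (auto simp: card_2_iff)
    with V B have xy: "x \<in> A" "y \<in> A" "x \<noteq> y" "x \<noteq> 0" "y \<noteq> 0" by auto
    \<comment> \<open>Stated for all pairs, so that every nonzero element can be compared with the
      fixed \<open>x\<close>.\<close>
    have seven: "\<exists>u\<in>A. u \<noteq> 0 \<and> proportional x y \<and> proportional n (x * u) \<and> is_nth_power k n"
      if "x \<in> A" "y \<in> A" "x \<noteq> y" "x \<noteq> 0" "y \<noteq> 0" for x y
      using seven_elements[OF assms(1-3) B(1,2) _ that] B(3) by auto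
    have similar: "proportional a x" if "a \<in> A" "a \<noteq> 0" for a
      using seven[of a x] that xy by (cases "a = x") auto
    obtain u where u: "u \<in> A" "u \<noteq> 0" "proportional n (x * u)" "is_nth_power k n"
      using seven[OF xy] by blast
    have "proportional n (x ^ 2)"
      using u similar[OF u(1,2)] xy by (simp add: proportional_def order_mult power2_eq_square)
    then obtain c where c: "c \<noteq> 0" "n = smult c (x ^ 2)"
      using assms(2) xy by (auto elim: proportionalE)
    obtain d where d: "d ^ 2 = c" using nth_root_exists[of 2 c] by auto
    then have "d \<noteq> 0" using c by auto
    \<comment> \<open>So \<open>smult d x\<close> is the root s of the extra hypothesis, and every
      element of \<open>A\<close> turns out to be a constant multiple of it.\<close>
    have "n = (smult d x) ^ 2" using c d by (simp add: smult_power)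
    then have "\<not> A \<subseteq> {smult c (smult d x) | c. True}" using assms(4) u(4) by blast
    moreover have "a \<in> {smult c (smult d x) | c. True}" if "a \<in> A" for a
    proof (cases "a = 0")
      case True
      then have "a = smult 0 (smult d x)" by simp
      then show ?thesis by blast
    next
      case False
      with that have "proportional a x" by (rule similar)
      then obtain e where "a = smult e x" using False xy(4) by (elim proportionalE) blast+
      then have "a = smult (e / d) (smult d x)" using \<open>d \<noteq> 0\<close> by simp
      then show ?thesis by blast
    qed
    ultimately show False by blast
  qed
  moreover have "card A \<le> 5" if "\<not> is_square n" "even k"
  proof (rule ccontr)
    assume "\<not> card A \<le> 5"
    then have "card A = 6" using main by simp
    then show False using six_elements assms(1-3) that by blast
  qed
  ultimately show ?thesis by blast
qed

end
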